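(* Let $n,k,r,\delta$ be integers with $\delta>2$ and $k>r\ge 1$. There exists an optimal quaternary $[n,k,d]$ $(r,\delta)$-LRC code with minimum distance $d=4$ if and only if there is an integer $l\ge 2$ such that one of the following holds: (1) $\delta=4$, $r=3$, $n=6l-1$, $k=3l-1$; (2) $\delta=3$, $r=3$, $n=5l$, $k=3l-1$; (3) $\delta=3$, $r=2$, $n=4l$, $k=2l-1$; (4) $\delta=4$, $r=2$, $n=5l-1$, $k=2l-1$; (5) $\delta=3$, $r=3$, $n=5l-1$, $k=3l-2$; (6) $\delta=4$, $r=3$, $n=6l-2$, $k=3l-2$; (7) $\delta=4$, $1\le r\le 3$, $n=l(r+3)$, $k=rl$.
   Context: Quaternary means over $\mathbb{F}_4$. For a linear code $\mathcal C\subseteq\mathbb{F}_q^n$ and $R\subseteq[n]=\{1,\dots,n\}$, $\mathcal C|_R$ is the code obtained by puncturing (deleting) the coordinates outside $R$. An $[n,k,d]$ linear code $\mathcal C$ is an $(r,\delta)$-LRC code if for every $i\in[n]$ there is $R_i\subseteq[n]$ with $i\in R_i$, $|R_i|\le r+\delta-1$, such that $\mathcal C|_{R_i}$ has minimum distance at least $\delta$ (every nonzero word has weight at least $\delta$). Every such code satisfies $d\le n-k+1-(\lceil k/r\rceil-1)(\delta-1)$; it is $d$-optimal if equality holds. An $(r,\delta)$-LRC code is $r$-optimal if it is not an $(r',\delta)$-LRC code for any $1\le r'<r$. "Optimal $(r,\delta)$-LRC code" means an $(r,\delta)$-LRC code that is both $d$-optimal and $r$-optimal, with $d\ge\delta>2$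 and $k>r\ge1$. *)

theory Defs
  imports Complex_Main "HOL-Library.Function_Algebras" "HOL-Library.Cardinality"
begin

text \<open>
  For a set \<open>I\<close> of coordinates, the space \<open>F\<close> to the power \<open>I\<close> is represented by the functions
  \<open>nat \<Rightarrow> 'q\<close> vanishing outside \<open>I\<close>, so that all codes, punctured ones included, live in one
  vector space.
\<close>

definition words :: "nat set \<Rightarrow> (nat \<Rightarrow> 'q::field) set" where
  "words I = {w. \<forall>i. i \<notin> I \<longrightarrow> w i = 0}"

definition scale_word :: "'q::field \<Rightarrow> (nat \<Rightarrow> 'q) \<Rightarrow> nat \<Rightarrow> 'q" where
  "scale_word c w = (\<lambda>i. c * w i)"

global_interpretation word: vector_space "scale_word :: 'q::field \<Rightarrow> (nat \<Rightarrow> 'q) \<Rightarrow> nat \<Rightarrow> 'q"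
  by unfold_locales (auto simp: scale_word_def fun_eq_iff algebra_simps)

definition weight :: "(nat \<Rightarrow> 'q::field) \<Rightarrow> nat" where
  "weight w = card {i. w i \<noteq> 0}"

text \<open>For linear codes only. The value at the zero code (an infimum over the empty set) is junk.\<close>

definition min_distance :: "(nat \<Rightarrow> 'q::field) set \<Rightarrow> nat" where
  "min_distance C = (INF w\<in>C - {0}. weight w)"

text \<open>Holds vacuously for the zero code.\<close>

definition min_distance_at_least :: "nat \<Rightarrow> (nat \<Rightarrow> 'q::field) set \<Rightarrow> bool" where
  "min_distance_at_least \<delta> C \<longleftrightarrow> (\<forall>w\<in>C. w \<noteq> 0 \<longrightarrow> \<delta> \<le> weight w)"

definition linear_code :: "nat \<Rightarrow> nat \<Rightarrow> nat \<Rightarrow> (nat \<Rightarrow> 'q::field) set \<Rightarrow> bool" where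
  "linear_code n k d C \<longleftrightarrow>
     C \<subseteq> words {1..n} \<and> word.subspace C \<and> word.dim C = k \<and> min_distance C = d"

definition puncture :: "(nat \<Rightarrow> 'q::field) set \<Rightarrow> nat set \<Rightarrow> (nat \<Rightarrow> 'q) set" where
  "puncture C R = (\<lambda>w i. if i \<in> R then w i else 0) ` C"

definition is_lrc :: "nat \<Rightarrow> nat \<Rightarrow> nat \<Rightarrow> (nat \<Rightarrow> 'q::field) set \<Rightarrow> bool" where
  "is_lrc n r \<delta> C \<longleftrightarrow>
     (\<forall>i\<in>{1..n}. \<exists>R\<subseteq>{1..n}. i \<in> R \<and> card R \<le> r + \<delta> - 1 \<and>
        min_distance_at_least \<delta> (puncture C R))"

definition d_optimal :: "nat \<Rightarrow> nat \<Rightarrow> nat \<Rightarrow> nat \<Rightarrow> nat \<Rightarrow> bool" where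
  "d_optimal n k d r \<delta> \<longleftrightarrow>
     int d = int n - int k + 1 - (\<lceil>real k / real r\<rceil> - 1) * (int \<delta> - 1)"

definition r_optimal :: "nat \<Rightarrow> nat \<Rightarrow> nat \<Rightarrow> (nat \<Rightarrow> 'q::field) set \<Rightarrow> bool" where
  "r_optimal n r \<delta> C \<longleftrightarrow> (\<forall>r'. 1 \<le> r' \<and> r' < r \<longrightarrow> \<not> is_lrc n r' \<delta> C)"

definition optimal_lrc ::
    "nat \<Rightarrow> nat \<Rightarrow> nat \<Rightarrow> nat \<Rightarrow> nat \<Rightarrow> (nat \<Rightarrow> 'q::field) set \<Rightarrow> bool" where
  "optimal_lrc n k d r \<delta> C \<longleftrightarrow>
     linear_code n k d C \<and> is_lrc n r \<delta> C \<and> d_optimal n k d r \<delta> \<and> r_optimal n r \<delta> C \<and>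
     d \<ge> \<delta> \<and> \<delta> > 2 \<and> k > r \<and> r \<ge> 1"

end

theory Submission
  imports Defs "HOL-Library.FuncSet"
begin

text \<open>
  Write \<open>k(S)\<close> for the dimension of the subcode vanishing on a coordinate set \<open>S\<close>, and
  \<open>t = \<lceil>k/r\<rceil>\<close>. Adjoining to \<open>S\<close> the repair set of a coordinate that is nonzero on the subcode
  increases \<open>|S| + k(S)\<close> by at least \<open>\<delta> - 1\<close> and lowers \<open>k(S)\<close> by at most \<open>r\<close>. After \<open>t - 1\<close>
  such steps the Singleton bound for the remaining subcode gives the bound on \<open>d\<close>, so for a
  \<open>d\<close>-optimal code no choice of repair sets may ever gain more than \<open>\<delta> - 1\<close> in a step.

  By \<open>r\<close>-optimality some coordinate has only repair sets of full size \<open>r + \<delta> - 1\<close>; such a set must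
  carry an MDS code of dimension \<open>r\<close>, and over a field with four elements the Hamming bound forces
  \<open>r \<le> 3\<close>. If \<open>\<delta> = 3\<close>, \<open>d = 4\<close> and \<open>k = rt\<close>, then after \<open>t - 1\<close> steps exactly \<open>r + 3\<close> coordinates
  remain, every repair set of a remaining coordinate consists of \<open>r + 2\<close> of them, and restarting the
  greedy choice with two of these overlapping sets gains too much.

  The optimal codes come from the hyperoval \<open>(1, x, x\<^sup>2)\<close>, \<open>(0, 0, 1)\<close>, \<open>(0, 1, 0)\<close>, any three points of
  which are independent. For \<open>\<delta> = 4\<close> its three rows are checks on each block of coordinates. For
  \<open>\<delta> = 3\<close> the middle row is instead summed over all blocks, and projecting from \<open>(0, 1, 0)\<close> keeps the
  other five points distinct in each block.
\<close>

section \<open>Dimensions of codes over finite fields\<close>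

text \<open>Translation by an element of a fibre maps the kernel bijectively onto that fibre. This
  count takes the place of rank-nullity below.\<close>

lemma card_fibres:
  fixes D :: "'a::ab_group_add set" and f :: "'a \<Rightarrow> 'b::ab_group_add"
  assumes "finite D" and diff: "\<And>v w. v \<in> D \<Longrightarrow> w \<in> D \<Longrightarrow> v - w \<in> D"
    and add: "\<And>v w. v \<in> D \<Longrightarrow> w \<in> D \<Longrightarrow> v + w \<in> D"
    and f: "\<And>v w. f (v + w) = f v + f w"
  shows "card D = card (f ` D) * card {w \<in> D. f w = 0}"
proof -
  have f_diff: "f (v - w) = f v - f w" for v w
    using f[of "v - w" w] by simp
  have "card {w \<in> D. f w = y} = card {w \<in> D. f w = 0}" if "y \<in> f ` D" for y
  proof -
    from that obtain v where v: "v \<in> D" "f v = y" by auto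
    have "bij_betw (\<lambda>w. v + w) {w \<in> D. f w = 0} {w \<in> D. f w = y}"
      by (rule bij_betwI[where g = "\<lambda>w. w - v"]) (auto simp: v f f_diff add diff)
    then show ?thesis by (rule bij_betw_same_card[symmetric])
  qed
  then have "(\<Sum>y\<in>f ` D. card {w \<in> D. f w = y}) = card (f ` D) * card {w \<in> D. f w = 0}"
    by simp
  moreover have "card D = (\<Sum>y\<in>f ` D. card {w \<in> D. f w = y})"
    using sum.image_gen[OF \<open>finite D\<close>, of "\<lambda>_. 1::nat" f] by simp
  ultimately show ?thesis by simp
qed

lemma card_words:
  assumes "finite T"
  shows "card (words T :: (nat \<Rightarrow> 'q::field) set) = CARD('q) ^ card T"
proof -
  have "bij_betw (\<lambda>w. restrict w T) (words T) (T \<rightarrow>\<^sub>E (UNIV :: 'q set))"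
    by (rule bij_betwI[where g = "\<lambda>w i. if i \<in> T then w i else 0"])
      (auto simp: words_def fun_eq_iff PiE_def extensional_def)
  then show ?thesis
    using assms by (simp add: bij_betw_same_card card_funcsetE)
qed

lemma finite_words:
  assumes "finite T" "finite (UNIV :: 'q set)"
  shows "finite (words T :: (nat \<Rightarrow> 'q::field) set)"
proof -
  have "CARD('q) > 0" using assms(2) by (simp add: card_gt_0_iff)
  then have "card (words T :: (nat \<Rightarrow> 'q::field) set) > 0"
    using card_words[OF assms(1), where 'q = 'q] by simp
  then show ?thesis by (simp add: card_gt_0_iff)
qed

text \<open>Adjoining a vector outside the span multiplies the count by the field size: if one word
  had two different coefficients of \<open>b\<close>, dividing by their difference would put
  \<open>b\<close> into the span of \<open>B\<close>.\<close>

lemma card_span: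
  fixes B :: "(nat \<Rightarrow> 'q::field) set"
  assumes "finite B" "word.independent B"
  shows "card (word.span B) = CARD('q) ^ card B"
  using assms
proof (induction B)
  case empty
  then show ?case by simp
next
  case (insert b B)
  then have b: "b \<notin> word.span B" and B: "word.independent B"
    by (auto simp: word.independent_insert)
  have inj: "inj_on (\<lambda>(c, v). scale_word c b + v) (UNIV \<times> word.span B)"
  proof (rule inj_onI, clarify)
    fix c c' v v'
    assume v: "v \<in> word.span B" "v' \<in> word.span B"
      and eq: "scale_word c b + v = scale_word c' b + v'"
    have "scale_word (c - c') b = v' - v"
      using eq by (simp add: word.scale_left_diff_distrib algebra_simps)
    then have "scale_word (c - c') b \<in> word.span B"
      using v by (simp add: word.span_diff)
    then have "scale_word (inverse (c - c')) (scale_word (c - c') b) \<in> word.span B"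
      by (rule word.span_scale)
    then have "c = c'" using b by (cases "c = c'") simp_all
    then show "c = c' \<and> v = v'" using eq by simp
  qed
  have "word.span (insert b B) = (\<lambda>(c, v). scale_word c b + v) ` (UNIV \<times> word.span B)"
  proof (intro set_eqI iffI)
    fix x assume "x \<in> word.span (insert b B)"
    then obtain c where "x - scale_word c b \<in> word.span B"
      by (auto simp: word.span_insert)
    then show "x \<in> (\<lambda>(c, v). scale_word c b + v) ` (UNIV \<times> word.span B)"
      by (intro image_eqI[where x = "(c, x - scale_word c b)"]) auto
  next
    fix x assume "x \<in> (\<lambda>(c, v). scale_word c b + v) ` (UNIV \<times> word.span B)"
    then obtain c v where "v \<in> word.span B" "x = scale_word c b + v" by auto
    then have "x - scale_word c b \<in> word.span B" by simp
    then show "x \<in> word.span (insert b B)" unfolding word.span_insert by blast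
  qed
  then have "card (word.span (insert b B)) = card ((UNIV :: 'q set) \<times> word.span B)"
    using card_image[OF inj] by simp
  then show ?case
    using insert B by (simp add: card_cartesian_product)
qed

text \<open>The bridge from counting to linear algebra: a finite field has more than one element, so
  comparing exponents turns relations between cardinalities into relations between
  dimensions.\<close>

lemma card_subspace:
  fixes D :: "(nat \<Rightarrow> 'q::field) set"
  assumes "finite D" "word.subspace D"
  shows "card D = CARD('q) ^ word.dim D"
proof -
  obtain B where B: "B \<subseteq> D" "word.independent B" "D \<subseteq> word.span B" "card B = word.dim D"
    using word.basis_exists by blast
  have "word.span B = D"
    using B assms(2) by (meson subset_antisym word.span_minimal)
  then show ?thesis
    using card_span[OF finite_subset[OF B(1) assms(1)] B(2)] B(4) by simp
qed

lemma card_field_gt_1: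
  assumes "finite (UNIV :: 'q::field set)"
  shows "CARD('q) > 1"
proof -
  have "card {0, 1 :: 'q} \<le> CARD('q)" by (rule card_mono) (use assms in auto)
  then show ?thesis by simp
qed

section \<open>Shortened and punctured codes\<close>

definition shorten :: "(nat \<Rightarrow> 'q::field) set \<Rightarrow> nat set \<Rightarrow> (nat \<Rightarrow> 'q) set" where
  "shorten C S = {w \<in> C. \<forall>i\<in>S. w i = 0}"

lemma shorten_shorten: "shorten (shorten C S) R = shorten C (S \<union> R)"
  by (auto simp: shorten_def)

lemma shorten_empty: "shorten C {} = C"
  by (auto simp: shorten_def)

lemma shorten_subset: "shorten C S \<subseteq> C"
  by (auto simp: shorten_def)

lemma subspace_shorten: "word.subspace C \<Longrightarrow> word.subspace (shorten C S)"
  unfolding word.subspace_def shorten_def by (auto simp: scale_word_def)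

lemma subspace_puncture:
  assumes "word.subspace C"
  shows "word.subspace (puncture C R)"
  unfolding word.subspace_def puncture_def
proof (intro conjI ballI allI)
  show "0 \<in> (\<lambda>w i. if i \<in> R then w i else 0) ` C"
    using word.subspace_0[OF assms] by (intro image_eqI[where x = 0]) (auto simp: fun_eq_iff)
next
  fix x y assume "x \<in> (\<lambda>w i. if i \<in> R then w i else 0) ` C" "y \<in> (\<lambda>w i. if i \<in> R then w i else 0) ` C"
  then obtain v w where "v \<in> C" "w \<in> C" "x = (\<lambda>i. if i \<in> R then v i else 0)" "y = (\<lambda>i. if i \<in> R then w i else 0)"
    by auto
  then show "x + y \<in> (\<lambda>w i. if i \<in> R then w i else 0) ` C"
    using word.subspace_add[OF assms] by (intro image_eqI[where x = "v + w"]) (auto simp: fun_eq_iff)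
next
  fix c x assume "x \<in> (\<lambda>w i. if i \<in> R then w i else 0) ` C"
  then obtain v where "v \<in> C" "x = (\<lambda>i. if i \<in> R then v i else 0)"
    by auto
  then show "scale_word c x \<in> (\<lambda>w i. if i \<in> R then w i else 0) ` C"
    using word.subspace_scale[OF assms]
    by (intro image_eqI[where x = "scale_word c v"]) (auto simp: fun_eq_iff scale_word_def)
qed

lemma subspace_words: "word.subspace (words T)"
  unfolding word.subspace_def words_def by (auto simp: scale_word_def)

text \<open>Rank-nullity for the restriction to \<open>R\<close>: its kernel on \<open>D\<close> is
  the shortened code and its image the punctured one.\<close>

lemma dim_shorten_puncture:
  fixes D :: "(nat \<Rightarrow> 'q::field) set"
  assumes "finite (UNIV :: 'q set)" "finite D" "word.subspace D"
  shows "word.dim D = word.dim (shorten D R) + word.dim (puncture D R)"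
proof -
  let ?f = "\<lambda>w i. if i \<in> R then w i else (0 :: 'q)"
  have "card D = card (?f ` D) * card {w \<in> D. ?f w = 0}"
    by (rule card_fibres)
      (use assms in \<open>auto simp: fun_eq_iff word.subspace_add word.subspace_diff\<close>)
  moreover have "{w \<in> D. ?f w = 0} = shorten D R"
    by (auto simp: shorten_def fun_eq_iff)
  ultimately have "card D = card (puncture D R) * card (shorten D R)"
    by (simp add: puncture_def)
  moreover have "finite (puncture D R)" "finite (shorten D R)"
    using assms(2) by (auto simp: puncture_def shorten_def)
  ultimately have "CARD('q) ^ word.dim D = CARD('q) ^ (word.dim (shorten D R) + word.dim (puncture D R))"
    using assms by (simp add: card_subspace subspace_puncture subspace_shorten power_add)
  then show ?thesis
    using card_field_gt_1[OF assms(1)] by simp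
qed

lemma dim_mono_finite:
  fixes D E :: "(nat \<Rightarrow> 'q::field) set"
  assumes "finite (UNIV :: 'q set)" "finite E" "word.subspace D" "word.subspace E" "D \<subseteq> E"
  shows "word.dim D \<le> word.dim E"
proof -
  have "card D \<le> card E" using assms by (simp add: card_mono)
  then have "CARD('q) ^ word.dim D \<le> CARD('q) ^ word.dim E"
    using assms finite_subset by (metis card_subspace)
  then show ?thesis
    using card_field_gt_1[OF assms(1)] by simp
qed

lemma dim_words:
  fixes T :: "nat set"
  assumes "finite (UNIV :: 'q::field set)" "finite T"
  shows "word.dim (words T :: (nat \<Rightarrow> 'q) set) = card T"
proof -
  have "CARD('q) ^ word.dim (words T :: (nat \<Rightarrow> 'q) set) = CARD('q) ^ card T"
    using card_words[OF assms(2), where 'q = 'q] card_subspace[OF finite_words[OF assms(2,1)] subspace_words]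
    by simp
  then show ?thesis
    using card_field_gt_1[OF assms(1)] by simp
qed

lemma dim_pos_iff:
  fixes D :: "(nat \<Rightarrow> 'q::field) set"
  assumes "finite (UNIV :: 'q set)" "finite D" "word.subspace D"
  shows "word.dim D > 0 \<longleftrightarrow> (\<exists>w\<in>D. w \<noteq> 0)"
proof -
  have "word.dim D = 0 \<longleftrightarrow> card D = 1"
    using card_subspace[OF assms(2,3)] card_field_gt_1[OF assms(1)] by auto
  also have "\<dots> \<longleftrightarrow> D = {0}"
    using word.subspace_0[OF assms(3)] by (auto simp: card_1_singleton_iff)
  finally show ?thesis
    using word.subspace_0[OF assms(3)] by auto
qed

section \<open>Singleton and Hamming bounds\<close>

lemma singleton_bound:
  fixes D :: "(nat \<Rightarrow> 'q::field) set"
  assumes fin: "finite (UNIV :: 'q set)" "finite T" and D: "word.subspace D" "D \<subseteq> words T"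
    and d: "min_distance_at_least d D" and pos: "word.dim D > 0"
  shows "word.dim D + d \<le> card T + 1"
proof -
  have finD: "finite D" using finite_words[OF fin(2,1)] D(2) finite_subset by blast
  obtain w where w: "w \<in> D" "w \<noteq> 0"
    using pos dim_pos_iff[OF fin(1) finD D(1)] by auto
  have sub: "{i. v i \<noteq> 0} \<subseteq> T" if "v \<in> D" for v
    using D(2) that by (auto simp: words_def)
  have "d \<le> card T"
    using d w card_mono[OF fin(2) sub[OF w(1)]] by (auto simp: min_distance_at_least_def weight_def)
  \<comment> \<open>\<open>U\<close> omits \<open>d - 1\<close> coordinates of \<open>T\<close>. A
    word vanishing on \<open>U\<close> is too light to be nonzero, so restriction to
    \<open>U\<close> loses no dimension.\<close>
  obtain U where U: "U \<subseteq> T" "card U = card T - (d - 1)"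
    by (meson diff_le_self obtain_subset_with_card_n)
  have finU: "finite U" using U fin finite_subset by blast
  have zero: "v = 0" if "v \<in> shorten D U" for v
  proof (rule ccontr)
    assume "v \<noteq> 0"
    have vD: "v \<in> D" using that by (simp add: shorten_def)
    then have "{i. v i \<noteq> 0} \<subseteq> T - U" using that sub by (auto simp: shorten_def)
    then have "weight v \<le> card (T - U)"
      unfolding weight_def by (rule card_mono[rotated]) (use fin in auto)
    also have "\<dots> = card T - card U" using U finU by (simp add: card_Diff_subset)
    finally have "weight v \<le> d - 1" using U \<open>d \<le> card T\<close> by linarith
    \<comment> \<open>This covers \<open>d = 0\<close>, where truncation makes \<open>d - 1\<close>
      zero.\<close>
    moreover have "weight v > 0"
      using \<open>v \<noteq> 0\<close> finite_subset[OF sub[OF vD] fin(2)]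
      by (auto simp: weight_def card_gt_0_iff fun_eq_iff)
    moreover have "d \<le> weight v" using d vD \<open>v \<noteq> 0\<close> by (auto simp: min_distance_at_least_def)
    ultimately show False by linarith
  qed
  have "word.dim (shorten D U) = 0"
    using zero dim_pos_iff[OF fin(1) finite_subset[OF shorten_subset finD] subspace_shorten[OF D(1)]]
    by blast
  moreover have "word.dim (puncture D U) \<le> card U"
  proof -
    have "puncture D U \<subseteq> words U" by (auto simp: puncture_def words_def)
    then show ?thesis
      using dim_mono_finite[OF fin(1) finite_words[OF finU fin(1)] subspace_puncture[OF D(1)] subspace_words]
        dim_words[OF fin(1) finU] by metis
  qed
  ultimately have "word.dim D \<le> card U"
    using dim_shorten_puncture[OF fin(1) finD D(1), of U] by linarith
  then show ?thesis using U \<open>d \<le> card T\<close> by linarith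
qed

text \<open>Sphere packing: \<open>E\<close> is the ball of radius one around zero. Two of its
  elements differ in at most two positions, so the translates of \<open>E\<close> by codewords are
  disjoint.\<close>

lemma hamming_bound:
  fixes D :: "(nat \<Rightarrow> 'q::field) set"
  assumes fin: "finite (UNIV :: 'q set)" "finite T" and D: "word.subspace D" "D \<subseteq> words T"
    and d: "min_distance_at_least 3 D"
  shows "CARD('q) ^ word.dim D * (1 + card T * (CARD('q) - 1)) \<le> CARD('q) ^ card T"
proof -
  have finD: "finite D" using finite_words[OF fin(2,1)] D(2) finite_subset by blast
  define e :: "nat \<times> 'q \<Rightarrow> nat \<Rightarrow> 'q" where "e = (\<lambda>(i, a) j. if j = i then a else 0)"
  define E where "E = insert 0 (e ` (T \<times> (UNIV - {0})))"
  have "inj_on e (T \<times> (UNIV - {0}))"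
  proof (rule inj_onI)
    fix x y assume *: "x \<in> T \<times> (UNIV - {0})" "y \<in> T \<times> (UNIV - {0})" "e x = e y"
    obtain i a j b where xy: "x = (i, a)" "y = (j, b)" by fastforce
    show "x = y"
      using * fun_cong[OF *(3), of i] by (auto simp: xy e_def split: if_splits dest: fun_cong)
  qed
  moreover have "0 \<notin> e ` (T \<times> (UNIV - {0}))"
  proof
    assume "0 \<in> e ` (T \<times> (UNIV - {0}))"
    then obtain x where x: "0 = e x" "x \<in> T \<times> (UNIV - {0})" by (rule imageE)
    have "e x (fst x) = 0" unfolding x(1)[symmetric] by simp
    then show False using x(2) by (auto simp: e_def)
  qed
  ultimately have cardE: "card E = 1 + card T * (CARD('q) - 1)" and finE: "finite E"
    using fin by (auto simp: E_def card_image card_cartesian_product card_Diff_singleton)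
  have Esub: "E \<subseteq> words T" by (auto simp: E_def e_def words_def)
  have E1: "\<exists>i. \<forall>j. j \<noteq> i \<longrightarrow> x j = 0" if "x \<in> E" for x
    using that by (auto simp: E_def e_def)
  have "inj_on (\<lambda>(c, x). c + x) (D \<times> E)"
  proof (rule inj_onI, clarify)
    fix c x c' x' assume *: "c \<in> D" "x \<in> E" "c' \<in> D" "x' \<in> E" "c + x = c' + x'"
    obtain i i' where i: "\<forall>j. j \<noteq> i \<longrightarrow> x j = 0" "\<forall>j. j \<noteq> i' \<longrightarrow> x' j = 0"
      using E1 * by metis
    have eq: "c - c' = x' - x" using *(5) by (simp add: algebra_simps)
    have "{j. (c - c') j \<noteq> 0} \<subseteq> {i, i'}"
      unfolding eq using i by auto
    then have "weight (c - c') \<le> card {i, i'}"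
      unfolding weight_def by (rule card_mono[rotated]) simp
    also have "\<dots> \<le> 2" by (simp add: card_insert_if)
    finally have "weight (c - c') < 3" by simp
    moreover have "c - c' \<in> D" using * D word.subspace_diff by blast
    ultimately have "c - c' = 0" using d by (force simp: min_distance_at_least_def)
    then show "c = c' \<and> x = x'" using *(5) by simp
  qed
  then have "card (D \<times> E) \<le> card (words T :: (nat \<Rightarrow> 'q) set)"
  proof (rule card_inj_on_le)
    show "(\<lambda>(c, x). c + x) ` (D \<times> E) \<subseteq> words T"
      using D(2) Esub by (auto intro!: word.subspace_add[OF subspace_words])
    show "finite (words T :: (nat \<Rightarrow> 'q) set)" using finite_words[OF fin(2,1)] .
  qed
  then show ?thesis
    using cardE card_subspace[OF finD D(1)] card_words[OF fin(2), where 'q = 'q]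
    by (simp add: card_cartesian_product)
qed

text \<open>At length dimension plus two the Hamming bound reads
  \<open>1 + (word.dim E + 2) * 3 \<le> 16\<close>. The case \<open>\<delta> = 4\<close> reduces to
  \<open>\<delta> = 3\<close> by puncturing one coordinate, which costs at most one in distance and
  nothing in dimension.\<close>

lemma quaternary_MDS_dim_le:
  fixes D :: "(nat \<Rightarrow> 'q::field) set"
  assumes q: "CARD('q) = 4" and "finite T" and D: "word.subspace D" "D \<subseteq> words T"
    and d: "min_distance_at_least \<delta> D" and \<delta>: "\<delta> = 3 \<or> \<delta> = 4"
    and T: "card T + 1 = word.dim D + \<delta>"
  shows "word.dim D \<le> 3"
proof -
  have fin: "finite (UNIV :: 'q set)" using q by (intro card_ge_0_finite) simp
  have main: "word.dim E \<le> 3"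
    if "finite U" "word.subspace E" "E \<subseteq> words U" "min_distance_at_least 3 E" "card U = word.dim E + 2"
    for U and E :: "(nat \<Rightarrow> 'q) set"
  proof -
    have "4 ^ word.dim E * (1 + (word.dim E + 2) * 3) \<le> (4::nat) ^ word.dim E * 16"
      using hamming_bound[OF fin that(1-4)] that(5) q by (simp add: power_add)
    then show ?thesis by simp
  qed
  show ?thesis
  proof (cases "\<delta> = 3")
    case True
    then show ?thesis using main[OF \<open>finite T\<close> D] d T by simp
  next
    case False
    with \<delta> have \<delta>4: "\<delta> = 4" by simp
    then obtain i where i: "i \<in> T" using T by fastforce
    let ?U = "T - {i}"
    have finD: "finite D" using finite_words[OF \<open>finite T\<close> fin] D(2) finite_subset by blast
    have w: "3 \<le> weight (\<lambda>j. if j \<in> ?U then w j else 0)" if "w \<in> D" "w \<noteq> 0" for w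
    proof -
      have T': "{j. w j \<noteq> 0} \<subseteq> T" using D(2) that by (auto simp: words_def)
      have "4 \<le> weight w" using d that \<delta>4 by (auto simp: min_distance_at_least_def)
      also have "weight w \<le> card (insert i {j. (if j \<in> ?U then w j else 0) \<noteq> 0})"
        unfolding weight_def
        by (rule card_mono) (use T' \<open>finite T\<close> in \<open>auto intro: finite_subset[of _ T]\<close>)
      also have "\<dots> \<le> Suc (weight (\<lambda>j. if j \<in> ?U then w j else 0))"
        unfolding weight_def by (rule card_insert_le_m1) auto
      finally show ?thesis by simp
    qed
    have "w = 0" if "w \<in> shorten D ?U" for w
    proof (rule ccontr)
      assume "w \<noteq> 0"
      moreover have "(\<lambda>j. if j \<in> ?U then w j else 0) = (\<lambda>_. 0)" "w \<in> D"
        using that by (auto simp: shorten_def fun_eq_iff)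
      ultimately show False using w[of w] by (simp add: weight_def)
    qed
    then have "word.dim (shorten D ?U) = 0"
      using dim_pos_iff[OF fin finite_subset[OF shorten_subset finD] subspace_shorten[OF D(1)]]
      by blast
    then have dim: "word.dim (puncture D ?U) = word.dim D"
      using dim_shorten_puncture[OF fin finD D(1), of ?U] by simp
    have "min_distance_at_least 3 (puncture D ?U)"
      unfolding min_distance_at_least_def puncture_def
    proof (intro ballI impI)
      fix v assume "v \<in> (\<lambda>w i. if i \<in> ?U then w i else 0) ` D" and "v \<noteq> 0"
      then obtain u where "u \<in> D" "v = (\<lambda>i. if i \<in> ?U then u i else 0)" by blast
      moreover from this \<open>v \<noteq> 0\<close> have "u \<noteq> 0" by (auto simp: zero_fun_def)
      ultimately show "3 \<le> weight v" using w by blast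
    qed
    moreover have "puncture D ?U \<subseteq> words ?U" by (auto simp: puncture_def words_def)
    moreover have "card ?U = word.dim D + 2" using T \<delta>4 i \<open>finite T\<close> by simp
    ultimately show ?thesis
      using main[of ?U "puncture D ?U"] dim subspace_puncture[OF D(1)] \<open>finite T\<close> by simp
  qed
qed

section \<open>Greedy choice of repair sets\<close>

text \<open>Here \<open>d\<close> is only a lower bound for the minimum distance and
  \<open>r\<close> any valid locality. One code can thus be examined under several values of both,
  which is how distance five and smaller localities are refuted later.\<close>

locale lrc_code =
  fixes C :: "(nat \<Rightarrow> 'q::field) set" and n r \<delta> d :: nat
  assumes fin: "finite (UNIV :: 'q set)"
    and sub: "word.subspace C" and len: "C \<subseteq> words {1..n}"
    and lrc: "is_lrc n r \<delta> C" and dist: "min_distance_at_least d C"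
    and \<delta>: "\<delta> > 2" and r: "r \<ge> 1"
begin

abbreviation \<kappa> :: "nat set \<Rightarrow> nat" where
  "\<kappa> S \<equiv> word.dim (shorten C S)"

lemma finC: "finite C"
  using finite_words[OF _ fin] len finite_subset by blast

lemma fin_shorten: "finite (shorten C S)"
  using finC shorten_subset finite_subset by blast

lemma \<kappa>_pos_iff: "\<kappa> S > 0 \<longleftrightarrow> (\<exists>w\<in>shorten C S. w \<noteq> 0)"
  by (rule dim_pos_iff[OF fin fin_shorten subspace_shorten[OF sub]])

lemma \<kappa>_antimono: "S \<subseteq> S' \<Longrightarrow> \<kappa> S' \<le> \<kappa> S"
  by (rule dim_mono_finite[OF fin fin_shorten subspace_shorten[OF sub] subspace_shorten[OF sub]])
    (auto simp: shorten_def)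

lemma shorten_words: "shorten C S \<subseteq> words ({1..n} - S)"
  using len by (auto simp: shorten_def words_def)

lemma dist_bound:
  assumes "S \<subseteq> {1..n}" "\<kappa> S > 0"
  shows "card S + \<kappa> S + d \<le> n + 1"
proof -
  have "finite S" using assms finite_subset by blast
  have "min_distance_at_least d (shorten C S)"
    using dist shorten_subset by (auto simp: min_distance_at_least_def)
  from singleton_bound[OF fin _ subspace_shorten[OF sub] shorten_words this assms(2)]
  have "\<kappa> S + d \<le> card ({1..n} - S) + 1" by simp
  moreover have "card ({1..n} - S) = n - card S" "card S \<le> n"
    using assms(1) \<open>finite S\<close> card_mono[OF _ assms(1)] by (auto simp: card_Diff_subset)
  ultimately show ?thesis by linarith
qed

text \<open>The subcode vanishing on \<open>S\<close>, restricted to \<open>R\<close>, lives on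
  \<open>R - S\<close> and is nonzero because of \<open>w\<close>. Its dimension is
  \<open>\<kappa> S - \<kappa> (S \<union> R)\<close>, and the Singleton bound limits it.\<close>

lemma local_step:
  assumes "w \<in> shorten C S" "w i \<noteq> 0" "i \<in> R" "finite R"
    and R: "min_distance_at_least \<delta>' (puncture C R)"
  shows "\<kappa> S + \<delta>' \<le> \<kappa> (S \<union> R) + card (R - S) + 1"
proof -
  let ?D = "shorten C S"
  let ?P = "puncture ?D R"
  have "?P \<subseteq> puncture C R" using shorten_subset by (auto simp: puncture_def)
  then have "min_distance_at_least \<delta>' ?P" using R by (auto simp: min_distance_at_least_def)
  moreover have "word.dim ?P > 0"
  proof -
    have "finite ?P" using fin_shorten by (simp add: puncture_def)
    moreover have "(\<lambda>i. if i \<in> R then w i else 0) \<in> ?P" "(\<lambda>i. if i \<in> R then w i else 0) \<noteq> 0"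
      using assms(1-3) by (auto simp: puncture_def fun_eq_iff)
    ultimately show ?thesis
      using dim_pos_iff[OF fin _ subspace_puncture[OF subspace_shorten[OF sub]]] by blast
  qed
  moreover have "?P \<subseteq> words (R - S)" by (auto simp: puncture_def words_def shorten_def)
  ultimately have "word.dim ?P + \<delta>' \<le> card (R - S) + 1"
    using singleton_bound[OF fin _ subspace_puncture[OF subspace_shorten[OF sub]]] \<open>finite R\<close> by blast
  then show ?thesis
    using dim_shorten_puncture[OF fin fin_shorten subspace_shorten[OF sub], of S R]
    by (simp add: shorten_shorten)
qed

lemma lrc_obtain:
  assumes "i \<in> {1..n}"
  obtains R where "R \<subseteq> {1..n}" "i \<in> R" "card R + 1 \<le> r + \<delta>" "finite R"
    "min_distance_at_least \<delta> (puncture C R)"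
proof -
  obtain R where "R \<subseteq> {1..n}" "i \<in> R" "card R \<le> r + \<delta> - 1" "min_distance_at_least \<delta> (puncture C R)"
    using lrc assms unfolding is_lrc_def by blast
  then show ?thesis using that[of R] finite_subset[of R] \<delta> by simp
qed

lemma card_Un: "finite S \<Longrightarrow> finite R \<Longrightarrow> card (S \<union> R) = card S + card (R - S)"
  by (metis Un_Diff_cancel card_Un_disjoint Diff_disjoint finite_Diff)

text \<open>One step per repair set; the assumed dimension keeps the subcode nonzero throughout. The
  start \<open>S\<close> is arbitrary so that the first choices can be prescribed.\<close>

lemma greedy:
  assumes "S \<subseteq> {1..n}" "\<kappa> S \<ge> r * m + 1"
  shows "\<exists>S'\<subseteq>{1..n}. \<kappa> S \<le> \<kappa> S' + r * m \<and> card S + \<kappa> S + m * (\<delta> - 1) \<le> card S' + \<kappa> S'"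
  using assms
proof (induction m arbitrary: S)
  case 0
  then show ?case by auto
next
  case (Suc m)
  have "\<kappa> S > 0" using Suc.prems by simp
  then obtain w i where w: "w \<in> shorten C S" "w i \<noteq> 0"
    by (auto simp: \<kappa>_pos_iff fun_eq_iff)
  then have "i \<in> {1..n}" using len by (auto simp: shorten_def words_def)
  then obtain R where R: "R \<subseteq> {1..n}" "i \<in> R" "card R + 1 \<le> r + \<delta>" "finite R"
    "min_distance_at_least \<delta> (puncture C R)"
    by (rule lrc_obtain)
  have finS: "finite S" using Suc.prems finite_subset by blast
  have step: "\<kappa> S + \<delta> \<le> \<kappa> (S \<union> R) + card (R - S) + 1"
    by (rule local_step[OF w R(2,4,5)])
  have "card (R - S) \<le> card R" using R(4) by (simp add: card_mono)
  with step R(3) have le: "\<kappa> S \<le> \<kappa> (S \<union> R) + r" by linarith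
  then have "r * m + 1 \<le> \<kappa> (S \<union> R)" using Suc.prems(2) by simp
  then obtain S' where S': "S' \<subseteq> {1..n}" "\<kappa> (S \<union> R) \<le> \<kappa> S' + r * m"
    "card (S \<union> R) + \<kappa> (S \<union> R) + m * (\<delta> - 1) \<le> card S' + \<kappa> S'"
    using Suc.IH[of "S \<union> R"] Suc.prems(1) R(1) by auto
  then show ?case
    using le step card_Un[OF finS R(4)] \<delta> by (intro exI[of _ S']) auto
qed

text \<open>After \<open>m\<close> greedy steps the subcode is still nonzero, and its Singleton
  bound closes the estimate. For empty \<open>S\<close> and
  \<open>m = \<lceil>k/r\<rceil> - 1\<close> this is the general bound on the minimum
  distance.\<close>

lemma greedy_bound:
  assumes "S \<subseteq> {1..n}" "\<kappa> S \<ge> r * m + 1"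
  shows "card S + \<kappa> S + m * (\<delta> - 1) + d \<le> n + 1"
proof -
  obtain S' where S': "S' \<subseteq> {1..n}" "\<kappa> S \<le> \<kappa> S' + r * m" "card S + \<kappa> S + m * (\<delta> - 1) \<le> card S' + \<kappa> S'"
    using greedy[OF assms] by blast
  have "card S' + \<kappa> S' + d \<le> n + 1"
    by (rule dist_bound) (use S' assms in auto)
  with S' show ?thesis by linarith
qed

text \<open>A coordinate that is zero on the whole subcode enlarges \<open>S\<close> for free and
  sharpens the greedy bound by one. Under equality in the bound no such coordinate exists.\<close>

lemma zero_coordinate:
  assumes "S \<subseteq> {1..n}" "i \<in> {1..n} - S" "\<And>w. w \<in> shorten C S \<Longrightarrow> w i = 0" "\<kappa> S \<ge> r * m + 1"
  shows "card S + \<kappa> S + m * (\<delta> - 1) + d \<le> n"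
proof -
  have "shorten C (insert i S) = shorten C S" using assms(3) by (auto simp: shorten_def)
  moreover have "card (insert i S) = card S + 1"
    using assms(1,2) finite_subset[OF assms(1)] by simp
  ultimately show ?thesis using greedy_bound[of "insert i S" m] assms by simp
qed

lemma optimal_imp_not_dvd:
  assumes opt: "n + 1 = word.dim C + m * (\<delta> - 1) + d" and d: "d = \<delta> + 1" and "m \<ge> 1"
    and k: "word.dim C = r * (m + 1)"
  shows False
proof -
  obtain S where S: "S \<subseteq> {1..n}" "\<kappa> {} \<le> \<kappa> S + r * m" "card {} + \<kappa> {} + m * (\<delta> - 1) \<le> card S + \<kappa> S"
    using greedy[of "{}" m] k r by (auto simp: shorten_empty)
  have finS: "finite S" using S finite_subset by blast
  \<comment> \<open>Since \<open>r\<close> divides the dimension, a full \<open>r\<close> remains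
    after \<open>m\<close> steps; this leaves no slack below.\<close>
  have "\<kappa> S \<ge> r" using S(2) k by (simp add: shorten_empty)
  have eq: "card S + \<kappa> S + d = n + 1"
    using dist_bound[OF S(1)] S(3) opt \<open>\<kappa> S \<ge> r\<close> r by (simp add: shorten_empty)
  have wit: "\<exists>w\<in>shorten C S. w i \<noteq> 0" if "i \<in> {1..n} - S" for i
    using zero_coordinate[OF S(1) that, of 0] eq \<open>\<kappa> S \<ge> r\<close> r by force
  have loc: "R \<inter> S = {} \<and> card R + 1 = r + \<delta> \<and> \<kappa> S = r"
    if i: "i \<in> {1..n} - S" and R: "R \<subseteq> {1..n}" "i \<in> R" "card R + 1 \<le> r + \<delta>" "finite R"
      "min_distance_at_least \<delta> (puncture C R)" for i R
  proof -
    obtain w where "w \<in> shorten C S" "w i \<noteq> 0" using wit[OF i] by auto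
    from local_step[OF this R(2,4,5)]
    have step: "\<kappa> S + \<delta> \<le> \<kappa> (S \<union> R) + card (R - S) + 1" .
    \<comment> \<open>Otherwise \<open>S \<union> R\<close> would exceed the Singleton bound, which
      \<open>S\<close> already meets with equality.\<close>
    have "\<kappa> (S \<union> R) = 0"
    proof (rule ccontr)
      assume "\<kappa> (S \<union> R) \<noteq> 0"
      then have "card (S \<union> R) + \<kappa> (S \<union> R) + d \<le> n + 1"
        using S(1) R(1) by (intro dist_bound) auto
      then show False using step eq card_Un[OF finS R(4)] \<delta> by linarith
    qed
    \<comment> \<open>The chain \<open>r + \<delta> \<le> \<kappa> S + \<delta> \<le> card (R - S) +
      1 \<le> card R + 1 \<le> r + \<delta>\<close> forces equality everywhere.\<close>
    moreover have le: "card (R - S) \<le> card R" using R(4) by (simp add: card_mono)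
    ultimately have "card (R - S) = card R" "card R + 1 = r + \<delta>" "\<kappa> S = r"
      using step R(3) \<open>\<kappa> S \<ge> r\<close> by linarith+
    moreover from this have "R - S = R" using R(4) by (metis Diff_subset card_subset_eq)
    ultimately show ?thesis by blast
  qed
  define U where "U = {1..n} - S"
  have finU: "finite U" by (simp add: U_def)
  have "card U = n - card S" using S(1) finS by (simp add: U_def card_Diff_subset)
  \<comment> \<open>With \<open>d = \<delta> + 1\<close> and \<open>\<kappa> S = r\<close> this is
    one more than the size of a repair set inside \<open>U\<close>, so \<open>R\<close> misses
    exactly one coordinate \<open>j\<close>.\<close>
  then have cardU: "card U = \<kappa> S + \<delta>" using eq d by simp
  then have "U \<noteq> {}" using \<delta> by auto
  then obtain i where i: "i \<in> U" by auto
  then obtain R where R: "R \<subseteq> {1..n}" "i \<in> R" "card R + 1 \<le> r + \<delta>" "finite R"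
    "min_distance_at_least \<delta> (puncture C R)"
    using lrc_obtain[of i] by (auto simp: U_def)
  have Rloc: "R \<inter> S = {}" "card R + 1 = r + \<delta>" "\<kappa> S = r"
    using loc[OF _ R] i by (auto simp: U_def)
  have "R \<subseteq> U" using R(1) Rloc(1) by (auto simp: U_def)
  then have "card (U - R) = 1" using Rloc cardU R(4) by (simp add: card_Diff_subset)
  then obtain j where j: "U - R = {j}" by (auto simp: card_1_singleton_iff)
  then have jU: "j \<in> U" by auto
  then obtain R' where R': "R' \<subseteq> {1..n}" "j \<in> R'" "card R' + 1 \<le> r + \<delta>" "finite R'"
    "min_distance_at_least \<delta> (puncture C R')"
    using lrc_obtain[of j] by (auto simp: U_def)
  have "R' \<inter> S = {}" using loc[OF _ R'] jU by (auto simp: U_def)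
  then have "R' - R \<subseteq> {j}" using j R'(1) by (auto simp: U_def)
  then have cR': "card (R' - R) \<le> 1" using card_mono[of "{j}"] by fastforce
  \<comment> \<open>The greedy choice now restarts from the empty set with \<open>R\<close> first;
    \<open>m' = m - 1\<close> further steps remain.\<close>
  obtain w where "w \<in> shorten C {}" "w i \<noteq> 0"
    using wit i by (auto simp: U_def shorten_def)
  from local_step[OF this R(2,4,5)]
  have step: "word.dim C + \<delta> \<le> \<kappa> R + card R + 1" by (simp add: shorten_empty)
  obtain m' where m': "m = Suc m'" using \<open>m \<ge> 1\<close> by (cases m) auto
  have \<kappa>R: "\<kappa> R \<ge> r * m' + 1" using step Rloc k r by (simp add: m')
  show False
  proof (cases "\<exists>w\<in>shorten C R. w j \<noteq> 0")
    case True
    then obtain w where "w \<in> shorten C R" "w j \<noteq> 0" by auto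
    \<comment> \<open>\<open>R'\<close> adds at most the coordinate \<open>j\<close> to
      \<open>R\<close>, while a nonzero local word needs at least
      \<open>\<delta> - 1 \<ge> 2\<close> new coordinates.\<close>
    from local_step[OF this R'(2,4,5)] cR' \<delta>
    show False using \<kappa>_antimono[of R "R \<union> R'"] by simp
  next
    case False
    \<comment> \<open>The free coordinate \<open>j\<close> beats the optimal value by one.\<close>
    then have "card R + \<kappa> R + m' * (\<delta> - 1) + d \<le> n"
      using j by (intro zero_coordinate[OF R(1) _ _ \<kappa>R, of j]) (auto simp: U_def)
    then show False using step opt \<delta> by (simp add: m')
  qed
qed

lemma optimal_imp_r_le_3:
  assumes q: "CARD('q) = 4" and opt: "n + 1 = word.dim C + m * (\<delta> - 1) + d" and "m \<ge> 1"
    and k: "r * m + 1 \<le> word.dim C" and \<delta>34: "\<delta> = 3 \<or> \<delta> = 4"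
    and r_opt: "\<not> is_lrc n (r - 1) \<delta> C"
  shows "r \<le> 3"
proof -
  obtain i where i: "i \<in> {1..n}"
    and bad: "\<And>R. R \<subseteq> {1..n} \<Longrightarrow> i \<in> R \<Longrightarrow> card R \<le> r - 1 + \<delta> - 1 \<Longrightarrow>
      \<not> min_distance_at_least \<delta> (puncture C R)"
    using r_opt unfolding is_lrc_def by blast
  obtain R where R: "R \<subseteq> {1..n}" "i \<in> R" "card R + 1 \<le> r + \<delta>" "finite R"
    "min_distance_at_least \<delta> (puncture C R)"
    using lrc_obtain[OF i] .
  \<comment> \<open>A smaller repair set of \<open>i\<close> is excluded by the choice of
    \<open>i\<close>.\<close>
  have cR: "card R + 1 = r + \<delta>"
    using bad[OF R(1,2)] R(3,5) r \<delta> by fastforce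
  obtain w where "w \<in> shorten C {}" "w i \<noteq> 0"
    using zero_coordinate[of "{}" i m] i k opt by (fastforce simp: shorten_empty)
  from local_step[OF this R(2,4,5)]
  have step: "word.dim C + \<delta> \<le> \<kappa> R + card R + 1" by (simp add: shorten_empty)
  obtain m' where m': "m = Suc m'" using \<open>m \<ge> 1\<close> by (cases m) auto
  have "\<kappa> R \<ge> r * m' + 1" using step cR k r by (simp add: m')
  \<comment> \<open>With \<open>R\<close> as first choice, optimality caps its gain at
    \<open>\<delta> - 1\<close>. Hence the local code meets the Singleton bound and has dimension
    \<open>r\<close>.\<close>
  from greedy_bound[OF R(1) this] have "card R + \<kappa> R + 1 \<le> word.dim C + \<delta>"
    using opt \<delta> by (simp add: m')
  then have "word.dim C = \<kappa> R + r" using step cR by linarith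
  then have dim: "word.dim (puncture C R) = r"
    using dim_shorten_puncture[OF fin finC sub, of R] by simp
  have "puncture C R \<subseteq> words R" by (auto simp: puncture_def words_def)
  from quaternary_MDS_dim_le[OF q R(4) subspace_puncture[OF sub] this R(5) \<delta>34]
  show ?thesis using dim cR by simp
qed

end

text \<open>The coordinates outside \<open>S\<close> carry an MDS subcode of length
  \<open>r' + 3\<close> and dimension \<open>r'\<close>. A repair set of \<open>i\<close> must
  annihilate this subcode, or else the Singleton bound is violated, and that takes all
  \<open>r' + 3\<close> coordinates, more than locality \<open>r < r'\<close> allows.\<close>

lemma (in lrc_code) no_smaller_locality:
  assumes "\<delta> = 4" "d = 4" and S: "S \<subseteq> {1..n}" "i \<in> {1..n} - S" "n = card S + r' + 3"
    and \<kappa>: "\<kappa> S \<ge> r'" and "r < r'"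
  shows False
proof -
  have finS: "finite S" using S finite_subset by blast
  obtain R where R: "R \<subseteq> {1..n}" "i \<in> R" "card R + 1 \<le> r + \<delta>" "finite R"
    "min_distance_at_least \<delta> (puncture C R)"
    using lrc_obtain[of i] S by auto
  obtain w where "w \<in> shorten C S" "w i \<noteq> 0"
    using zero_coordinate[OF S(1,2), of 0] assms by fastforce
  from local_step[OF this R(2,4,5)]
  have step: "\<kappa> S + \<delta> \<le> \<kappa> (S \<union> R) + card (R - S) + 1" .
  have le: "card (R - S) \<le> card R" using R(4) by (simp add: card_mono)
  show False
  proof (cases "\<kappa> (S \<union> R) = 0")
    case True
    then show False using step le R(3) assms by linarith
  next
    case False
    then have "card (S \<union> R) + \<kappa> (S \<union> R) + d \<le> n + 1"
      using S(1) R(1) by (intro dist_bound) auto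
    then show False using step assms card_Un[OF finS R(4)] by linarith
  qed
qed

section \<open>Necessary conditions on the parameters\<close>

lemma d_optimal_iff:
  assumes "r * m < k" "k \<le> r * (m + 1)" "\<delta> \<ge> 1"
  shows "d_optimal n k d r \<delta> \<longleftrightarrow> n + 1 = k + m * (\<delta> - 1) + d"
proof -
  have r: "r > 0" using assms by (cases r) auto
  have "real (r * m) < real k" "real k \<le> real (r * (m + 1))"
    using assms by (simp_all only: of_nat_less_iff of_nat_le_iff)
  \<comment> \<open>So \<open>m\<close> is the number of greedy steps, and the integer formula
    becomes an equation in \<open>nat\<close> without subtraction of lengths.\<close>
  then have ceil: "\<lceil>real k / real r\<rceil> = int m + 1"
    using r by (intro ceiling_unique) (auto simp: field_simps)
  have "int m * (int \<delta> - 1) = int (m * (\<delta> - 1))" using assms by (simp add: of_nat_diff)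
  then have "(\<lceil>real k / real r\<rceil> - 1) * (int \<delta> - 1) = int (m * (\<delta> - 1))"
    by (simp only: ceil add_diff_cancel_right')
  then have "d_optimal n k d r \<delta> \<longleftrightarrow> int d = int n - int k + 1 - int (m * (\<delta> - 1))"
    unfolding d_optimal_def by (simp only:)
  moreover have "int d = int n - int k + 1 - int x \<longleftrightarrow> n + 1 = k + x + d" for x
    by arith
  ultimately show ?thesis by blast
qed

lemma min_distance_eqI:
  assumes "min_distance_at_least d C" "\<not> min_distance_at_least (d + 1) C"
  shows "min_distance C = d"
proof -
  have "d \<le> weight w" if "w \<in> C - {0}" for w
    using assms(1) that by (auto simp: min_distance_at_least_def)
  moreover obtain w where "w \<in> C - {0}" "weight w \<le> d"
    using assms(2) by (auto simp: min_distance_at_least_def not_less_eq_eq)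
  ultimately show ?thesis
    unfolding min_distance_def by (intro cInf_eq_minimum) (auto intro: antisym)
qed

lemma min_distance_at_least_min_distance: "min_distance_at_least (min_distance C) C"
  unfolding min_distance_at_least_def min_distance_def by (auto intro!: cInf_lower)

lemma optimal_lrc_parameters:
  fixes C :: "(nat \<Rightarrow> 'q::field) set"
  assumes q: "CARD('q) = 4" and opt: "optimal_lrc n k 4 r \<delta> C"
  shows "\<exists>m\<ge>1. r * m < k \<and> k \<le> r * (m + 1) \<and> n + 1 = k + m * (\<delta> - 1) + 4 \<and> r \<le> 3 \<and>
    (\<delta> = 4 \<or> \<delta> = 3 \<and> k \<noteq> r * (m + 1))"
proof -
  have *: "C \<subseteq> words {1..n}" "word.subspace C" "word.dim C = k" "min_distance C = 4" "is_lrc n r \<delta> C"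
    "d_optimal n k 4 r \<delta>" "r_optimal n r \<delta> C" "\<delta> \<le> 4" "\<delta> > 2" "r < k" "r \<ge> 1"
    using opt by (auto simp: optimal_lrc_def linear_code_def)
  have "finite (UNIV :: 'q set)" using q by (intro card_ge_0_finite) simp
  moreover have "min_distance_at_least 4 C"
    using min_distance_at_least_min_distance[of C] *(4) by simp
  ultimately have C: "lrc_code C n r \<delta> 4"
    using * by (intro lrc_code.intro)
  define m where "m = (k - 1) div r"
  have "r * m \<le> k - 1" "k - 1 < r * (m + 1)"
    using dividend_less_times_div[of r "k - 1"] *(11) by (simp_all add: m_def)
  then have k: "r * m < k" "k \<le> r * (m + 1)" using * by linarith+
  have m: "m \<ge> 1" using k(2) *(10) by (cases m) auto
  have n: "n + 1 = k + m * (\<delta> - 1) + 4"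
    using d_optimal_iff[OF k] *(6,9) by simp
  have \<delta>34: "\<delta> = 3 \<or> \<delta> = 4" using * by linarith
  have "r \<le> 3"
  \<comment> \<open>Optimality of \<open>r\<close> says nothing about locality zero, so
    \<open>r = 1\<close> is separate.\<close>
  proof (cases "r = 1")
    case False
    then have "\<not> is_lrc n (r - 1) \<delta> C" using *(7,11) by (auto simp: r_optimal_def)
    then show ?thesis
      using lrc_code.optimal_imp_r_le_3[OF C q, of m] n m k \<delta>34 *(3) by simp
  qed simp
  moreover have "k \<noteq> r * (m + 1)" if "\<delta> = 3"
  proof
    assume "k = r * (m + 1)"
    then show False
      by (intro lrc_code.optimal_imp_not_dvd[OF C, of m]) (use n m that *(3) in simp_all)
  qed
  ultimately show ?thesis using n m k \<delta>34 by blast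
qed

section \<open>Codes from the hyperoval\<close>

text \<open>Multiplication by a nonzero \<open>x\<close> permutes the three nonzero elements;
  comparing their products gives \<open>x ^ 3 = 1\<close>.\<close>

lemma field_card_4_power_4:
  fixes x :: "'q::field"
  assumes q: "CARD('q) = 4"
  shows "x ^ 4 = x"
proof (cases "x = 0")
  case False
  have fin: "finite (UNIV :: 'q set)" using q by (intro card_ge_0_finite) simp
  let ?P = "\<Prod>y\<in>UNIV - {0 :: 'q}. y"
  have "bij_betw ((*) x) (UNIV - {0}) (UNIV - {0})"
    by (rule bij_betwI[where g = "(*) (inverse x)"]) (use False in auto)
  from prod.reindex_bij_betw[OF this, of "\<lambda>y. y"] have "(\<Prod>y\<in>UNIV - {0}. x * y) = ?P" .
  then have "x ^ card (UNIV - {0 :: 'q}) * ?P = ?P"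
    by (simp add: prod.distrib)
  moreover have "?P \<noteq> 0" using fin by simp
  moreover have "card (UNIV - {0 :: 'q}) = 3" using fin q by (simp add: card_Diff_singleton)
  ultimately have "x ^ 3 = 1" by simp
  then show ?thesis by (simp add: eval_nat_numeral)
qed simp

text \<open>Squaring twice is the identity. Injectivity of squaring is what allows
  \<open>(0, 1, 0)\<close> as a sixth point.\<close>

lemma field_card_4_square_inj:
  fixes x y :: "'q::field"
  assumes "CARD('q) = 4"
  shows "x\<^sup>2 = y\<^sup>2 \<longleftrightarrow> x = y"
proof
  assume "x\<^sup>2 = y\<^sup>2"
  then have "(x\<^sup>2)\<^sup>2 = (y\<^sup>2)\<^sup>2" by simp
  then show "x = y" using field_card_4_power_4[OF assms] by (simp flip: power_mult)
qed simp

text \<open>\<open>hyperoval e j p\<close> is the \<open>j\<close>-th coordinate of the \<open>p\<close>-th point, \<open>e\<close> enumerating the field.\<close>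

definition hyperoval :: "(nat \<Rightarrow> 'q::field) \<Rightarrow> nat \<Rightarrow> nat \<Rightarrow> 'q" where
  "hyperoval e j p =
    (if p < 4 then e p ^ j else if p = 4 then of_bool (j = 2) else of_bool (j = 1))"

text \<open>This is the determinant of three points, expanded along \<open>p\<close>. It is
  alternating, so sorted triples suffice. Three affine points give a Vandermonde product, point 4
  with two affine ones a difference of parameters, point 5 a difference of their squares, and both
  together \<open>-1\<close>.\<close>

lemma hyperoval_det:
  fixes e :: "nat \<Rightarrow> 'q::field"
  assumes q: "CARD('q) = 4" and e: "inj_on e {..<4}"
    and pts: "p < 6" "s < 6" "t < 6" "p \<noteq> s" "p \<noteq> t" "s \<noteq> t"
  defines "h \<equiv> hyperoval e"
  shows "(h 1 s * h 2 t - h 2 s * h 1 t) * h 0 p + (h 2 s * h 0 t - h 0 s * h 2 t) * h 1 p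
    + (h 0 s * h 1 t - h 1 s * h 0 t) * h 2 p \<noteq> 0"
proof -
  have e_neq: "e a \<noteq> e b \<and> (e a)\<^sup>2 \<noteq> (e b)\<^sup>2" if "a < 4" "b < 4" "a \<noteq> b" for a b
    using e that by (auto simp: inj_on_def field_card_4_square_inj[OF q])
  have vandermonde: "(b * c\<^sup>2 - b\<^sup>2 * c) + (b\<^sup>2 - c\<^sup>2) * a + (c - b) * a\<^sup>2 = (c - b) * (a - b) * (a - c)"
    for a b c :: 'q
    by (simp add: power2_eq_square algebra_simps)
  have aff: "h 0 x = 1" "h 1 x = e x" "h 2 x = (e x)\<^sup>2" if "x < 4" for x
    using that by (simp_all add: h_def hyperoval_def)
  have inf: "h 0 4 = 0" "h 1 4 = 0" "h 2 4 = 1" "h 0 5 = 0" "h 1 5 = 1" "h 2 5 = 0"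
    by (simp_all add: h_def hyperoval_def)
  define D where "D p s t = (h 1 s * h 2 t - h 2 s * h 1 t) * h 0 p
    + (h 2 s * h 0 t - h 0 s * h 2 t) * h 1 p + (h 0 s * h 1 t - h 1 s * h 0 t) * h 2 p" for p s t
  have swap: "D s p t = - D p s t" "D p t s = - D p s t" for p s t
    by (simp_all add: D_def algebra_simps)
  have sorted: "D p s t \<noteq> 0" if "p < s" "s < t" "t < 6" for p s t
  proof -
    from that consider "t < 4" | "t = 4" "s < 4" | "t = 5" "s < 4" | "t = 5" "s = 4"
      by linarith
    then show ?thesis
    proof cases
      case 1
      then have "s < 4" "p < 4" using \<open>p < s\<close> \<open>s < t\<close> by linarith+
      have "D p s t = (e t - e s) * (e p - e s) * (e p - e t)"
        unfolding D_def aff[OF \<open>t < 4\<close>] aff[OF \<open>s < 4\<close>] aff[OF \<open>p < 4\<close>] vandermonde[symmetric] by simp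
      then show ?thesis
        using e_neq[of t s] e_neq[of p s] e_neq[of p t] 1 \<open>s < 4\<close> \<open>p < 4\<close> that by simp
    next
      case 2
      then have "p < 4" using \<open>p < s\<close> by linarith
      then show ?thesis
        unfolding D_def \<open>t = 4\<close> aff[OF \<open>s < 4\<close>] aff[OF \<open>p < 4\<close>] inf
        using e_neq[of s p] 2 that by simp
    next
      case 3
      then have "p < 4" using \<open>p < s\<close> by linarith
      then show ?thesis
        unfolding D_def \<open>t = 5\<close> aff[OF \<open>s < 4\<close>] aff[OF \<open>p < 4\<close>] inf
        using e_neq[of p s] 3 that by simp
    next
      case 4
      then have "p < 4" using \<open>p < s\<close> by linarith
      then show ?thesis
        unfolding D_def \<open>t = 5\<close> \<open>s = 4\<close> aff[OF \<open>p < 4\<close>] inf by simp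
    qed
  qed
  have "D p s t \<noteq> 0"
    using pts sorted swap by (metis linorder_neqE_nat neg_equal_0_iff_equal)
  then show ?thesis by (simp add: D_def)
qed

text \<open>
  The linear form vanishing at the points \<open>s\<close> and \<open>t\<close> isolates the coordinate \<open>i\<close>. If \<open>t = 5\<close>, the
  point \<open>(0, 1, 0)\<close>, this form does not involve the middle row.
\<close>

lemma hyperoval_support:
  fixes e w :: "nat \<Rightarrow> 'q::field"
  assumes q: "CARD('q) = 4" and e: "inj_on e {..<4}"
    and T: "finite T" "i \<in> T"
    and pts: "pos i < 6" "s < 6" "t < 6" "pos i \<noteq> s" "pos i \<noteq> t" "s \<noteq> t"
    and supp: "\<And>j. j \<in> T \<Longrightarrow> w j \<noteq> 0 \<Longrightarrow> j \<noteq> i \<Longrightarrow> pos j = s \<or> pos j = t"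
    and 0: "(\<Sum>j\<in>T. hyperoval e 0 (pos j) * w j) = 0"
    and 2: "(\<Sum>j\<in>T. hyperoval e 2 (pos j) * w j) = 0"
    and 1: "t = 5 \<or> (\<Sum>j\<in>T. hyperoval e 1 (pos j) * w j) = 0"
  shows "w i = 0"
proof -
  let ?h = "hyperoval e"
  define a where "a = ?h 1 s * ?h 2 t - ?h 2 s * ?h 1 t"
  define b where "b = ?h 2 s * ?h 0 t - ?h 0 s * ?h 2 t"
  define c where "c = ?h 0 s * ?h 1 t - ?h 1 s * ?h 0 t"
  define f where "f p = a * ?h 0 p + b * ?h 1 p + c * ?h 2 p" for p
  have "b * (\<Sum>j\<in>T. ?h 1 (pos j) * w j) = 0"
    using 1
  proof
    assume "t = 5"
    then show ?thesis by (simp add: b_def hyperoval_def)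
  qed simp
  then have "a * (\<Sum>j\<in>T. ?h 0 (pos j) * w j) + b * (\<Sum>j\<in>T. ?h 1 (pos j) * w j)
      + c * (\<Sum>j\<in>T. ?h 2 (pos j) * w j) = 0"
    using 0 2 by simp
  then have "(\<Sum>j\<in>T. f (pos j) * w j) = 0"
    by (simp add: f_def sum_distrib_left sum.distrib distrib_right mult.assoc)
  also have "(\<Sum>j\<in>T. f (pos j) * w j) = (\<Sum>j\<in>T. if j = i then f (pos i) * w i else 0)"
  proof (rule sum.cong[OF refl])
    have "f s = 0" "f t = 0" by (auto simp: f_def a_def b_def c_def algebra_simps)
    then show "f (pos j) * w j = (if j = i then f (pos i) * w i else 0)" if "j \<in> T" for j
      using supp[OF that] by auto
  qed
  also have "\<dots> = f (pos i) * w i" using T by simp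
  finally show ?thesis
    using hyperoval_det[OF q e pts] by (simp add: f_def a_def b_def c_def)
qed

text \<open>If at most three coordinates were nonzero, those other than \<open>i\<close> would
  occupy at most two points. Padding them to exactly two distinct points \<open>s\<close> and
  \<open>t\<close> makes \<open>hyperoval_support\<close> applicable.\<close>

lemma hyperoval_weight_4:
  fixes e w :: "nat \<Rightarrow> 'q::field"
  assumes q: "CARD('q) = 4" and e: "inj_on e {..<4}"
    and T: "finite T" "pos ` T \<subseteq> {..<6}" "inj_on pos T"
    and sums: "\<And>j. j \<in> {0, 1, 2} \<Longrightarrow> (\<Sum>i\<in>T. hyperoval e j (pos i) * w i) = 0"
    and i: "i \<in> T" "w i \<noteq> 0"
  shows "4 \<le> card {i \<in> T. w i \<noteq> 0}"
proof (rule ccontr)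
  assume less: "\<not> ?thesis"
  let ?P = "{i \<in> T. w i \<noteq> 0}"
  let ?X = "pos ` (?P - {i})"
  have "card ?X \<le> card (?P - {i})" using T by (intro card_image_le) simp
  also have "\<dots> = card ?P - 1" using T i by simp
  finally have "card ?X \<le> 2" using less by linarith
  moreover have X: "?X \<subseteq> {..<6} - {pos i}" using T i by (auto simp: inj_on_def)
  moreover have "2 \<le> card ({..<6} - {pos i})" using T i by auto
  ultimately obtain Y where Y: "?X \<subseteq> Y" "Y \<subseteq> {..<6} - {pos i}" "card Y = 2"
    using exists_subset_between[of ?X 2 "{..<6} - {pos i}"] by auto
  then obtain s t where st: "Y = {s, t}" "s \<noteq> t" by (auto simp: card_2_iff)
  have "pos i < 6" "s < 6" "t < 6" "pos i \<noteq> s" "pos i \<noteq> t"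
    using T(2) i(1) Y(2) st(1) by auto
  moreover have "pos j = s \<or> pos j = t" if "j \<in> T" "w j \<noteq> 0" "j \<noteq> i" for j
    using Y(1) st(1) that by blast
  ultimately have "w i = 0"
    using st(2) sums by (rule_tac hyperoval_support[OF q e T(1) i(1), of pos s t]) simp_all
  then show False using i by simp
qed

text \<open>The same argument with \<open>t = 5\<close> fixed, which dispenses with the middle row.
  Positions below 5 keep this point distinct from all others.\<close>

lemma hyperoval_weight_3:
  fixes e w :: "nat \<Rightarrow> 'q::field"
  assumes q: "CARD('q) = 4" and e: "inj_on e {..<4}"
    and T: "finite T" "pos ` T \<subseteq> {..<5}" "inj_on pos T"
    and sums: "\<And>j. j \<in> {0, 2} \<Longrightarrow> (\<Sum>i\<in>T. hyperoval e j (pos i) * w i) = 0"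
    and i: "i \<in> T" "w i \<noteq> 0"
  shows "3 \<le> card {i \<in> T. w i \<noteq> 0}"
proof (rule ccontr)
  assume less: "\<not> ?thesis"
  let ?P = "{i \<in> T. w i \<noteq> 0}"
  let ?X = "pos ` (?P - {i})"
  have pi: "pos i < 5" using T i by auto
  have "card ?X \<le> card (?P - {i})" using T by (intro card_image_le) simp
  also have "\<dots> = card ?P - 1" using T i by simp
  finally have "card ?X \<le> 1" using less by linarith
  moreover have X: "?X \<subseteq> {..<5} - {pos i}" using T i by (auto simp: inj_on_def)
  moreover have "1 \<le> card ({..<5} - {pos i})" using T i by auto
  ultimately obtain Y where Y: "?X \<subseteq> Y" "Y \<subseteq> {..<5} - {pos i}" "card Y = 1"
    using exists_subset_between[of ?X 1 "{..<5} - {pos i}"] by auto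
  then obtain s where s: "Y = {s}" by (auto simp: card_1_singleton_iff)
  have "s < 5" "pos i \<noteq> s" using Y(2) s by auto
  moreover have "pos j = s" if "j \<in> T" "w j \<noteq> 0" "j \<noteq> i" for j
    using Y(1) s that by blast
  ultimately have "w i = 0"
    using sums pi by (rule_tac hyperoval_support[OF q e T(1) i(1), of pos s 5]) simp_all
  then show False using i by simp
qed

text \<open>The values of one check lie in the field, so its kernel has at least a fraction
  \<open>1 / CARD('q)\<close> of the words. Each check has its own range \<open>T j\<close>, which
  accommodates block checks and checks on the whole word together.\<close>

lemma dim_checks:
  fixes D :: "(nat \<Rightarrow> 'q::field) set" and a :: "'j \<Rightarrow> nat \<Rightarrow> 'q"
  assumes fin: "finite (UNIV :: 'q set)" "finite D" and sub: "word.subspace D" and "finite J"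
  shows "word.dim D \<le> word.dim {w \<in> D. \<forall>j\<in>J. (\<Sum>i\<in>T j. a j i * w i) = 0} + card J"
    and "word.subspace {w \<in> D. \<forall>j\<in>J. (\<Sum>i\<in>T j. a j i * w i) = 0}"
proof -
  let ?K = "\<lambda>J. {w \<in> D. \<forall>j\<in>J. (\<Sum>i\<in>T j. a j i * w i) = 0}"
  have subK: "word.subspace (?K J)" for J
    using sub unfolding word.subspace_def
    by (auto simp: scale_word_def distrib_left sum.distrib mult.left_commute[of _ "_ :: 'q"]
        simp flip: sum_distrib_left)
  from \<open>finite J\<close> show "word.dim D \<le> word.dim (?K J) + card J"
  proof (induction J)
    case (insert j J)
    let ?f = "\<lambda>w. \<Sum>i\<in>T j. a j i * w i"
    have finK: "finite (?K J)" for J using fin by simp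
    have "card (?K J) = card (?f ` ?K J) * card {w \<in> ?K J. ?f w = 0}"
      by (rule card_fibres[OF finK word.subspace_diff[OF subK] word.subspace_add[OF subK]])
        (simp_all add: distrib_left sum.distrib)
    moreover have "{w \<in> ?K J. ?f w = 0} = ?K (insert j J)" by auto
    moreover have "card (?f ` ?K J) * card (?K (insert j J)) \<le> CARD('q) * card (?K (insert j J))"
      by (intro mult_le_mono1 card_mono) (use fin in auto)
    ultimately have "card (?K J) \<le> CARD('q) * card (?K (insert j J))"
      by (simp only:)
    then have "CARD('q) ^ word.dim (?K J) \<le> CARD('q) ^ Suc (word.dim (?K (insert j J)))"
      by (simp only: card_subspace[OF finK subK] power_Suc)
    then have "word.dim (?K J) \<le> Suc (word.dim (?K (insert j J)))"
      using card_field_gt_1[OF fin(1)] power_le_imp_le_exp by blast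
    then show ?case using insert by simp
  qed simp
  show "word.subspace (?K J)" by (rule subK)
qed

section \<open>Block codes and their parity checks\<close>

definition block :: "nat \<Rightarrow> nat \<Rightarrow> nat \<Rightarrow> nat set" where
  "block B n b = {i \<in> {1..n}. (i - 1) div B = b}"

text \<open>
  The rows in \<open>L\<close> are checks on every block, the remaining ones are checks on the whole word. A last
  block shorter than \<open>B\<close> is obtained by truncation.
\<close>

definition block_code :: "(nat \<Rightarrow> 'q::field) \<Rightarrow> nat \<Rightarrow> nat \<Rightarrow> nat set \<Rightarrow> (nat \<Rightarrow> 'q) set" where
  "block_code e B n L = {w \<in> words {1..n}. \<forall>j\<in>{0, 1, 2}.
     if j \<in> L then \<forall>b. (\<Sum>i\<in>block B n b. hyperoval e j ((i - 1) mod B) * w i) = 0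
     else (\<Sum>i\<in>{1..n}. hyperoval e j ((i - 1) mod B) * w i) = 0}"

lemma block_code_local_check:
  assumes "w \<in> block_code e B n L" "j \<in> {0, 1, 2}" "j \<in> L"
  shows "(\<Sum>i\<in>block B n b. hyperoval e j ((i - 1) mod B) * w i) = 0"
proof -
  have "\<forall>b. (\<Sum>i\<in>block B n b. hyperoval e j ((i - 1) mod B) * w i) = 0"
    using bspec[OF conjunct2[OF assms(1)[unfolded block_code_def mem_Collect_eq]] assms(2)]
    unfolding if_P[OF assms(3)] .
  then show ?thesis ..
qed

lemma block_code_global_check:
  assumes "w \<in> block_code e B n L" "j \<in> {0, 1, 2}" "j \<notin> L"
  shows "(\<Sum>i\<in>{1..n}. hyperoval e j ((i - 1) mod B) * w i) = 0"
  using bspec[OF conjunct2[OF assms(1)[unfolded block_code_def mem_Collect_eq]] assms(2)]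
  unfolding if_not_P[OF assms(3)] .

lemma finite_block: "finite (block B n b)"
  by (simp add: block_def)

text \<open>The block fixes the quotient, so the remainder determines the coordinate: one block uses
  each hyperoval point at most once.\<close>

lemma inj_on_block: "inj_on (\<lambda>i. (i - 1) mod B) (block B n b)"
proof (rule inj_onI)
  fix x y assume "x \<in> block B n b" "y \<in> block B n b" "(x - 1) mod B = (y - 1) mod B"
  then have "x - 1 = y - 1"
    by (metis (mono_tags, lifting) block_def div_mult_mod_eq mem_Collect_eq)
  moreover have "x \<ge> 1" "y \<ge> 1"
    using \<open>x \<in> block B n b\<close> \<open>y \<in> block B n b\<close> by (simp_all add: block_def)
  ultimately show "x = y" by simp
qed

lemma image_mod_block: "B > 0 \<Longrightarrow> B \<le> m \<Longrightarrow> (\<lambda>i. (i - 1) mod B) ` block B n b \<subseteq> {..<m}"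
  by (auto intro: less_le_trans[OF mod_less_divisor])

lemma card_block_le:
  assumes "B > 0"
  shows "card (block B n b) \<le> B"
proof -
  have "card (block B n b) = card ((\<lambda>i. (i - 1) mod B) ` block B n b)"
    using card_image[OF inj_on_block] by simp
  also have "\<dots> \<le> card {..<B}" by (rule card_mono) (use assms in auto)
  finally show ?thesis by simp
qed

lemma block_code_local_weight:
  fixes e w :: "nat \<Rightarrow> 'q::field"
  assumes q: "CARD('q) = 4" and e: "inj_on e {..<4}" and B: "B > 0"
    and L: "L = {0, 1, 2} \<and> B \<le> 6 \<or> L = {0, 2} \<and> B \<le> 5"
    and w: "w \<in> block_code e B n L" "i \<in> block B n b" "w i \<noteq> 0"
  shows "card L + 1 \<le> card {i \<in> block B n b. w i \<noteq> 0}"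
proof -
  have sums: "(\<Sum>i\<in>block B n b. hyperoval e j ((i - 1) mod B) * w i) = 0" if "j \<in> L" for j
    using L that by (intro block_code_local_check[OF w(1)]) auto
  from L show ?thesis
  proof
    assume L: "L = {0, 1, 2} \<and> B \<le> 6"
    have "4 \<le> card {i \<in> block B n b. w i \<noteq> 0}"
      by (rule hyperoval_weight_4[where pos = "\<lambda>i. (i - 1) mod B" and w = w and i = i, OF q e finite_block[of B n b] _ inj_on_block[of B n b] _ w(2,3)])
        (use L sums image_mod_block[OF B, of _ n b] in auto)
    then show ?thesis using L by simp
  next
    assume L: "L = {0, 2} \<and> B \<le> 5"
    have "3 \<le> card {i \<in> block B n b. w i \<noteq> 0}"
      by (rule hyperoval_weight_3[where pos = "\<lambda>i. (i - 1) mod B" and w = w and i = i, OF q e finite_block[of B n b] _ inj_on_block[of B n b] _ w(2,3)])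
        (use L sums image_mod_block[OF B, of _ n b] in auto)
    then show ?thesis using L by simp
  qed
qed

text \<open>A word meeting two blocks has at least \<open>card L + 1 \<ge> 3\<close> nonzero entries
  in one and another outside it. For a word inside one block the checks on the whole word act as
  block checks, so all three rows apply.\<close>

lemma block_code_weight:
  fixes e w :: "nat \<Rightarrow> 'q::field"
  assumes q: "CARD('q) = 4" and e: "inj_on e {..<4}" and B: "B > 0"
    and L: "L = {0, 1, 2} \<and> B \<le> 6 \<or> L = {0, 2} \<and> B \<le> 5"
    and w: "w \<in> block_code e B n L" "w \<noteq> 0"
  shows "4 \<le> weight w"
proof -
  have supp: "{i. w i \<noteq> 0} \<subseteq> {1..n}" using w by (auto simp: block_code_def words_def)
  then have fin: "finite {i. w i \<noteq> 0}" using finite_subset by blast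
  obtain i where i: "w i \<noteq> 0" using w by (auto simp: fun_eq_iff)
  define b where "b = (i - 1) div B"
  have ib: "i \<in> block B n b" using i supp by (auto simp: block_def b_def)
  let ?P = "{i \<in> block B n b. w i \<noteq> 0}"
  have P: "card L + 1 \<le> card ?P"
    by (rule block_code_local_weight[OF q e B L w(1) ib i])
  show ?thesis
  proof (cases "{i. w i \<noteq> 0} \<subseteq> block B n b")
    case False
    then obtain i' where i': "w i' \<noteq> 0" "i' \<notin> block B n b" by auto
    have "card (insert i' ?P) \<le> weight w"
      unfolding weight_def by (rule card_mono[OF fin]) (use i' in auto)
    moreover have "card (insert i' ?P) = Suc (card ?P)" using i' by (simp add: finite_block)
    moreover have "card L \<ge> 2" using L by auto
    ultimately show ?thesis using P by linarith
  next
    case True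
    have sums: "(\<Sum>i\<in>block B n b. hyperoval e j ((i - 1) mod B) * w i) = 0" if "j \<in> {0, 1, 2}" for j
    proof (cases "j \<in> L")
      case True
      then show ?thesis by (rule block_code_local_check[OF w(1) that])
    next
      case False
      then have "(\<Sum>i\<in>{1..n}. hyperoval e j ((i - 1) mod B) * w i) = 0"
        by (rule block_code_global_check[OF w(1) that])
      moreover have "(\<Sum>i\<in>block B n b. hyperoval e j ((i - 1) mod B) * w i)
          = (\<Sum>i\<in>{1..n}. hyperoval e j ((i - 1) mod B) * w i)"
        by (rule sum.mono_neutral_left) (use True in \<open>auto simp: block_def\<close>)
      ultimately show ?thesis by simp
    qed
    have img: "(\<lambda>i. (i - 1) mod B) ` block B n b \<subseteq> {..<6}"
      using L by (intro image_mod_block[OF B]) auto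
    have "4 \<le> card ?P"
      by (rule hyperoval_weight_4[OF q e finite_block img inj_on_block sums ib i])
    also have "\<dots> \<le> weight w"
      unfolding weight_def by (rule card_mono[OF fin]) auto
    finally show ?thesis .
  qed
qed

lemma block_code_lrc:
  fixes e :: "nat \<Rightarrow> 'q::field"
  assumes q: "CARD('q) = 4" and e: "inj_on e {..<4}" and B: "B > 0" "B = r + card L"
    and L: "L = {0, 1, 2} \<and> B \<le> 6 \<or> L = {0, 2} \<and> B \<le> 5"
  shows "is_lrc n r (card L + 1) (block_code e B n L)"
  unfolding is_lrc_def
proof (intro ballI exI conjI)
  fix i assume i: "i \<in> {1..n}"
  define b where "b = (i - 1) div B"
  show "block B n b \<subseteq> {1..n}" "i \<in> block B n b" using i by (auto simp: block_def b_def)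
  show "card (block B n b) \<le> r + (card L + 1) - 1" using card_block_le[OF B(1)] B(2) by simp
  show "min_distance_at_least (card L + 1) (puncture (block_code e B n L) (block B n b))"
    unfolding min_distance_at_least_def puncture_def
  proof (intro ballI impI)
    fix v assume "v \<in> (\<lambda>w i. if i \<in> block B n b then w i else 0) ` block_code e B n L" "v \<noteq> 0"
    then obtain w where w: "w \<in> block_code e B n L" "v = (\<lambda>i. if i \<in> block B n b then w i else 0)"
      by blast
    obtain i where "v i \<noteq> 0" using \<open>v \<noteq> 0\<close> by (auto simp: fun_eq_iff)
    then have "i \<in> block B n b" "w i \<noteq> 0" using w(2) by (auto split: if_splits)
    from block_code_local_weight[OF q e B(1) L w(1) this]
    show "card L + 1 \<le> weight v" 
      by (simp add: weight_def w(2) conj_commute cong: conj_cong)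
  qed
qed

lemma block_code_dim:
  fixes e :: "nat \<Rightarrow> 'q::field"
  assumes fin: "finite (UNIV :: 'q set)" and "B > 0" "n \<le> B * l" and L: "L \<subseteq> {0, 1, 2}"
  shows "n \<le> word.dim (block_code e B n L) + card L * l + card ({0, 1, 2} - L)"
    and "word.subspace (block_code e B n L)"
proof -
  let ?J = "Inl ` (L \<times> {..<l}) \<union> Inr ` ({0, 1, 2} - L)"
  let ?D = "words {1..n} :: (nat \<Rightarrow> 'q) set"
  let ?a = "\<lambda>x i. hyperoval e (case x of Inl (j, b) \<Rightarrow> j | Inr j \<Rightarrow> j) ((i - 1) mod B)"
  let ?T = "\<lambda>x. case x of Inl (j, b) \<Rightarrow> block B n b | Inr j \<Rightarrow> {1..n}"
  have finL: "finite L" using L finite_subset by blast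
  \<comment> \<open>Only the first \<open>l\<close> blocks can be nonempty, which leaves finitely
    many checks to count.\<close>
  have empty: "block B n b = {}" if "b \<ge> l" for b
  proof -
    have "(i - 1) div B < l" if "i \<in> {1..n}" for i
    proof -
      have "i - 1 < l * B" using that \<open>n \<le> B * l\<close> by (simp add: mult.commute) linarith
      then show ?thesis by (rule less_mult_imp_div_less)
    qed
    then show ?thesis using that by (fastforce simp: block_def)
  qed
  have eq: "block_code e B n L = {w \<in> ?D. \<forall>x\<in>?J. (\<Sum>i\<in>?T x. ?a x i * w i) = 0}"
    unfolding block_code_def
  proof (rule Collect_cong, rule conj_cong[OF refl])
    fix w :: "nat \<Rightarrow> 'q"
    have "(\<forall>b. (\<Sum>i\<in>block B n b. hyperoval e j ((i - 1) mod B) * w i) = 0) \<longleftrightarrow>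
      (\<forall>b\<in>{..<l}. (\<Sum>i\<in>block B n b. hyperoval e j ((i - 1) mod B) * w i) = 0)" for j
    proof (intro iffI allI)
      fix b assume *: "\<forall>b\<in>{..<l}. (\<Sum>i\<in>block B n b. hyperoval e j ((i - 1) mod B) * w i) = 0"
      show "(\<Sum>i\<in>block B n b. hyperoval e j ((i - 1) mod B) * w i) = 0"
        using * empty[of b] by (cases "b < l") simp_all
    qed blast
    moreover have "(\<forall>j\<in>{0, 1, 2}. if j \<in> L then P j else Q j) \<longleftrightarrow>
        (\<forall>j\<in>L. P j) \<and> (\<forall>j\<in>{0, 1, 2} - L. Q j)" for P Q
      using L by (meson DiffD1 DiffD2 DiffI subsetD)
    ultimately show "(\<forall>j\<in>{0, 1, 2}. if j \<in> L then \<forall>b. (\<Sum>i\<in>block B n b. hyperoval e j ((i - 1) mod B) * w i) = 0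
        else (\<Sum>i\<in>{1..n}. hyperoval e j ((i - 1) mod B) * w i) = 0) \<longleftrightarrow>
      (\<forall>x\<in>?J. (\<Sum>i\<in>?T x. ?a x i * w i) = 0)"
      by (simp only: ball_Un ball_simps(9) sum.case split_paired_Ball_Sigma prod.case)
  qed
  have finJ: "finite ?J" using finL by simp
  have "card ?J = card L * l + card ({0, 1, 2} - L)"
    using finL by (subst card_Un_disjoint) (auto simp: card_image card_cartesian_product)
  then show "n \<le> word.dim (block_code e B n L) + card L * l + card ({0, 1, 2} - L)"
    using dim_checks(1)[where T = ?T and a = ?a, OF fin finite_words[OF finite_atLeastAtMost fin] subspace_words finJ,
        of 1 n]
    unfolding eq[symmetric] dim_words[OF fin finite_atLeastAtMost] by (simp only: card_atLeastAtMost diff_Suc_1 add.assoc)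
  show "word.subspace (block_code e B n L)"
    using dim_checks(2)[where T = ?T and a = ?a, OF fin finite_words[OF _ fin, of "{1..n}"] subspace_words finJ]
    unfolding eq by simp
qed

text \<open>Words supported on the full first block need to satisfy only its three checks. This
  supplies the MDS subcode for \<open>no_smaller_locality\<close>.\<close>

lemma block_code_shorten_dim:
  fixes e :: "nat \<Rightarrow> 'q::field"
  assumes fin: "finite (UNIV :: 'q set)" and "B \<le> n" "B > 0"
  shows "B \<le> word.dim (shorten (block_code e B n {0, 1, 2}) ({1..n} - {1..B})) + 3"
proof -
  let ?C = "block_code e B n {0, 1, 2}"
  let ?D = "words {1..B} :: (nat \<Rightarrow> 'q) set"
  let ?K = "{w \<in> ?D. \<forall>j\<in>{0, 1, 2}. (\<Sum>i\<in>{1..B}. hyperoval e j ((i - 1) mod B) * w i) = 0}"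
  have "finite {0, 1, 2 :: nat}" by simp
  note checks = dim_checks[where T = "\<lambda>_. {1..B}" and a = "\<lambda>j i. hyperoval e j ((i - 1) mod B)",
      OF fin finite_words[OF finite_atLeastAtMost fin] subspace_words this, of 1 B]
  have K: "B \<le> word.dim ?K + card {0, 1, 2 :: nat}"
    using checks(1) unfolding dim_words[OF fin finite_atLeastAtMost] card_atLeastAtMost diff_Suc_1 .
  have subK: "word.subspace ?K" by (rule checks(2))
  have "(i - 1) div B = 0 \<longleftrightarrow> i \<le> B" if "i \<ge> 1" for i
    using that \<open>B > 0\<close> by (cases i) (simp_all add: div_eq_0_iff Suc_le_eq)
  then have b0: "block B n 0 = {1..B}"
    using \<open>B \<le> n\<close> by (auto simp: block_def)
  have "?K \<subseteq> shorten ?C ({1..n} - {1..B})"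
  proof
    fix w assume w: "w \<in> ?K"
    have "(\<Sum>i\<in>block B n b. hyperoval e j ((i - 1) mod B) * w i) = 0" if "j \<in> {0, 1, 2}" for b j
    proof (cases "b = 0")
      case True
      show ?thesis using w that unfolding True b0 by blast
    next
      case False
      have "w i = 0" if "i \<in> block B n b" for i
      proof -
        have "i \<notin> block B n 0" using that False by (simp add: block_def)
        then show ?thesis using w by (simp add: b0 words_def)
      qed
      then show ?thesis by simp
    qed
    moreover have wB: "w \<in> words {1..B}" using w by blast
    then have "w \<in> words {1..n}" using \<open>B \<le> n\<close> by (auto simp: words_def)
    ultimately have "w \<in> ?C" by (simp add: block_code_def)
    then show "w \<in> shorten ?C ({1..n} - {1..B})"
      using wB by (simp add: shorten_def words_def)
  qed
  moreover have "finite (shorten ?C ({1..n} - {1..B}))"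
    by (rule finite_subset[OF _ finite_words[OF _ fin, of "{1..n}"]])
      (auto simp: shorten_def block_code_def)
  moreover have "word.subspace (shorten ?C ({1..n} - {1..B}))"
    by (rule subspace_shorten[OF block_code_dim(2)[OF fin \<open>B > 0\<close>, of n n]]) (use \<open>B > 0\<close> in auto)
  ultimately have "word.dim ?K \<le> word.dim (shorten ?C ({1..n} - {1..B}))"
    by (intro dim_mono_finite[OF fin _ subK])
  then show ?thesis using K by simp
qed

section \<open>Optimal codes with minimum distance four\<close>

lemma block_code_optimal:
  fixes e :: "nat \<Rightarrow> 'q::field"
  assumes q: "CARD('q) = 4" and e: "inj_on e {..<4}"
    and L: "L = {0, 1, 2} \<or> L = {0, 2}" and r: "1 \<le> r" "r \<le> 3" and m: "m \<ge> 1"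
    and k: "r * m < k" "k \<le> r * (m + 1)" and n: "n + 1 = k + m * card L + 4"
    and short: "n \<le> (r + card L) * (m + 1)"
  shows "optimal_lrc n k 4 r (card L + 1) (block_code e (r + card L) n L)"
proof -
  define \<delta> where "\<delta> = card L + 1"
  define B where "B = r + card L"
  let ?C = "block_code e B n L"
  have fin: "finite (UNIV :: 'q set)" using q by (intro card_ge_0_finite) simp
  have \<delta>: "\<delta> = 4 \<and> L = {0, 1, 2} \<or> \<delta> = 3 \<and> L = {0, 2}" using L by (auto simp: \<delta>_def)
  have B: "B > 0" "L = {0, 1, 2} \<and> B \<le> 6 \<or> L = {0, 2} \<and> B \<le> 5"
    using L r by (auto simp: B_def)
  have dim_ge: "n \<le> word.dim ?C + card L * (m + 1) + card ({0, 1, 2} - L)" and sub: "word.subspace ?C"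
    using block_code_dim[OF fin B(1), of n "m + 1" L e] L short by (auto simp: B_def)
  have len: "?C \<subseteq> words {1..n}" by (auto simp: block_code_def)
  have dist: "min_distance_at_least 4 ?C"
    using block_code_weight[OF q e B] by (auto simp: min_distance_at_least_def)
  have lrc: "is_lrc n r \<delta> ?C"
    using block_code_lrc[OF q e B(1) _ B(2)] by (simp add: B_def \<delta>_def)
  have code: "lrc_code ?C n r' \<delta> d'" if "1 \<le> r'" "is_lrc n r' \<delta> ?C" "min_distance_at_least d' ?C" for r' d'
    using \<delta> by (intro lrc_code.intro[OF fin sub len that(2,3) _ that(1)]) auto
  \<comment> \<open>The \<open>m + 1\<close> blocks give \<open>m * card L + 3\<close> checks in
    total, which is exactly \<open>n - k\<close>.\<close>
  have card_compl: "card ({0, 1, 2} - L) + card L = 3" using L by auto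
  have "k \<le> word.dim ?C"
    using dim_ge n card_compl by (simp add: algebra_simps)
  moreover from this have "word.dim ?C \<le> k"
    using lrc_code.greedy_bound[OF code[OF r(1) lrc dist], of "{}" m] k n by (simp add: shorten_empty \<delta>_def)
  ultimately have dim: "word.dim ?C = k" by simp
  \<comment> \<open>Distance five would violate the greedy bound by one.\<close>
  have "\<not> min_distance_at_least 5 ?C"
  proof
    assume "min_distance_at_least 5 ?C"
    then have "lrc_code ?C n r \<delta> 5" by (rule code[OF r(1) lrc])
    then show False using lrc_code.greedy_bound[of ?C n r \<delta> 5 "{}" m] k n dim by (simp add: shorten_empty \<delta>_def)
  qed
  then have "min_distance ?C = 4" using min_distance_eqI[of 4 ?C] dist by simp
  then have "linear_code n k 4 ?C" using len sub dim by (simp add: linear_code_def)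
  moreover have "d_optimal n k 4 r \<delta>"
    using d_optimal_iff[OF k] n by (simp add: \<delta>_def)
  moreover have "r_optimal n r \<delta> ?C"
    unfolding r_optimal_def
  proof (intro allI impI notI)
    fix r' assume r': "1 \<le> r' \<and> r' < r" and lrc': "is_lrc n r' \<delta> ?C"
    have D: "lrc_code ?C n r' \<delta> 4" by (rule code) (use r' lrc' dist in auto)
    have Bn: "B \<le> n"
    proof -
      have "r \<le> r * m" "card L \<le> m * card L" using m by simp_all
      then show ?thesis using n k(1) unfolding B_def by linarith
    qed
    from \<delta> show False
    proof
      assume \<delta>4: "\<delta> = 4 \<and> L = {0, 1, 2}"
      then have B3: "B = r + 3" by (simp add: B_def)
      \<comment> \<open>Everything outside the first block plays the role of \<open>S\<close>,
        leaving \<open>r + 3\<close> coordinates.\<close>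
      have "card ({1..n} - {1..B}) = n - B"
        using Bn by (subst card_Diff_subset) auto
      then have n_eq: "n = card ({1..n} - {1..B}) + r + 3"
        using Bn B3 by linarith
      have "B \<le> word.dim (shorten ?C ({1..n} - {1..B})) + 3"
        using block_code_shorten_dim[OF fin Bn B(1)] \<delta>4 by simp
      then have "r \<le> word.dim (shorten ?C ({1..n} - {1..B}))"
        using B3 by linarith
      moreover have "1 \<in> {1..n} - ({1..n} - {1..B})" using B(1) Bn by simp
      ultimately show False
        using lrc_code.no_smaller_locality[OF D _ refl Diff_subset _ n_eq] \<delta>4 r' by blast
    next
      assume \<delta>3: "\<delta> = 3 \<and> L = {0, 2}"
      have "k \<le> r' * (m + 1)"
      \<comment> \<open>Otherwise the smaller locality would permit \<open>m + 1\<close> greedy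
        steps, one too many for the length.\<close>
      proof (rule ccontr)
        assume "\<not> k \<le> r' * (m + 1)"
        then show False
          using lrc_code.greedy_bound[OF D, of "{}" "m + 1"] n dim \<delta>3 by (simp add: shorten_empty)
      qed
      moreover have "(r' + 1) * m \<le> r * m" using r' by (intro mult_le_mono1) simp
      \<comment> \<open>From \<open>r * m < k \<le> r' * (m + 1)\<close> and
        \<open>r' < r \<le> 3\<close> only \<open>r' = 2\<close>, \<open>r = 3\<close>,
        \<open>m = 1\<close>, \<open>k = 4\<close> survives, and there \<open>r'\<close> divides
        \<open>k\<close>.\<close>
      ultimately have "k = r' * (m + 1)" using k(1) r' r m by (simp add: algebra_simps)
      then show False
        by (intro lrc_code.optimal_imp_not_dvd[OF D, of m]) (use n dim \<delta>3 m in simp_all)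
    qed
  qed
  moreover have "k > r"
  proof -
    have "r \<le> r * m" using m by simp
    then show ?thesis using k(1) by linarith
  qed
  ultimately have "optimal_lrc n k 4 r \<delta> ?C"
    using lrc \<delta> r by (auto simp: optimal_lrc_def)
  then show ?thesis by (simp add: \<delta>_def B_def)
qed

text \<open>Here \<open>l = m + 1\<close> is \<open>\<lceil>k/r\<rceil>\<close>. For each
  \<open>r \<le> 3\<close> the listed cases run through the \<open>r\<close> possible values of
  \<open>k\<close>; for \<open>\<delta> = 3\<close> the multiple \<open>k = r * l\<close> is absent,
  and with it \<open>r = 1\<close>.\<close>

lemma optimal_parameters_iff:
  fixes n k r \<delta> m :: nat
  assumes "r \<ge> 1"
  shows "(let l = m + 1 in
      (\<delta> = 4 \<and> r = 3 \<and> n = 6 * l - 1 \<and> k = 3 * l - 1) \<or>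
      (\<delta> = 3 \<and> r = 3 \<and> n = 5 * l \<and> k = 3 * l - 1) \<or>
      (\<delta> = 3 \<and> r = 2 \<and> n = 4 * l \<and> k = 2 * l - 1) \<or>
      (\<delta> = 4 \<and> r = 2 \<and> n = 5 * l - 1 \<and> k = 2 * l - 1) \<or>
      (\<delta> = 3 \<and> r = 3 \<and> n = 5 * l - 1 \<and> k = 3 * l - 2) \<or>
      (\<delta> = 4 \<and> r = 3 \<and> n = 6 * l - 2 \<and> k = 3 * l - 2) \<or>
      (\<delta> = 4 \<and> 1 \<le> r \<and> r \<le> 3 \<and> n = l * (r + 3) \<and> k = r * l)) \<longleftrightarrow>
    r \<le> 3 \<and> r * m < k \<and> k \<le> r * (m + 1) \<and> n + 1 = k + m * (\<delta> - 1) + 4 \<and>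
      (\<delta> = 4 \<or> \<delta> = 3 \<and> k \<noteq> r * (m + 1))"
  (is "?lhs \<longleftrightarrow> ?rhs")
proof
  assume ?lhs
  then show ?rhs unfolding Let_def using assms
    by (elim disjE conjE) (hypsubst, simp add: algebra_simps)+
next
  assume rhs: ?rhs
  with assms consider "r = 1" "k = m + 1" | "r = 2" "k = 2 * m + 1 \<or> k = 2 * m + 2"
    | "r = 3" "k = 3 * m + 1 \<or> k = 3 * m + 2 \<or> k = 3 * m + 3"
  proof -
    from rhs assms consider "r = 1" | "r = 2" | "r = 3" by linarith
    then show thesis
    proof cases
      case 1
      then show thesis using rhs that(1) by simp
    next
      case 2
      then have "k = 2 * m + 1 \<or> k = 2 * m + 2" using rhs by simp linarith
      then show thesis using 2 that(2) by simp
    next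
      case 3
      then have "k = 3 * m + 1 \<or> k = 3 * m + 2 \<or> k = 3 * m + 3" using rhs by simp linarith
      then show thesis using 3 that(3) by simp
    qed
  qed
  moreover have "\<delta> = 3 \<or> \<delta> = 4" "n + 1 = k + m * (\<delta> - 1) + 4" "\<delta> = 3 \<Longrightarrow> k \<noteq> r * (m + 1)"
    using rhs by linarith+
  ultimately show ?lhs
    unfolding Let_def by cases (elim disjE; simp)+
qed

theorem mainTheorem2:
  fixes n k r \<delta> :: nat
  assumes "CARD('q::field) = 4"
    and "\<delta> > 2" and "k > r" and "r \<ge> 1"
  shows "(\<exists>C :: (nat \<Rightarrow> 'q) set. optimal_lrc n k 4 r \<delta> C) \<longleftrightarrow>
    (\<exists>l :: nat. l \<ge> 2 \<and>
      ((\<delta> = 4 \<and> r = 3 \<and> n = 6 * l - 1 \<and> k = 3 * l - 1) \<or>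
       (\<delta> = 3 \<and> r = 3 \<and> n = 5 * l \<and> k = 3 * l - 1) \<or>
       (\<delta> = 3 \<and> r = 2 \<and> n = 4 * l \<and> k = 2 * l - 1) \<or>
       (\<delta> = 4 \<and> r = 2 \<and> n = 5 * l - 1 \<and> k = 2 * l - 1) \<or>
       (\<delta> = 3 \<and> r = 3 \<and> n = 5 * l - 1 \<and> k = 3 * l - 2) \<or>
       (\<delta> = 4 \<and> r = 3 \<and> n = 6 * l - 2 \<and> k = 3 * l - 2) \<or>
       (\<delta> = 4 \<and> 1 \<le> r \<and> r \<le> 3 \<and> n = l * (r + 3) \<and> k = r * l)))"
  (is "?lhs \<longleftrightarrow> (\<exists>l. l \<ge> 2 \<and> ?params l)")
proof
  assume ?lhs
  then obtain m where "m \<ge> 1" and m: "r * m < k" "k \<le> r * (m + 1)" "n + 1 = k + m * (\<delta> - 1) + 4"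
    "r \<le> 3" "\<delta> = 4 \<or> \<delta> = 3 \<and> k \<noteq> r * (m + 1)"
    using optimal_lrc_parameters[OF assms(1)] by blast
  then have "?params (m + 1)"
    by (intro optimal_parameters_iff[OF assms(4), unfolded Let_def, THEN iffD2] conjI)
  then show "\<exists>l. l \<ge> 2 \<and> ?params l" using \<open>m \<ge> 1\<close> by (intro exI[of _ "m + 1"]) simp
next
  assume "\<exists>l. l \<ge> 2 \<and> ?params l"
  then obtain l where l: "l \<ge> 2" "?params l" by (elim exE conjE)
  then obtain m where m: "l = m + 1" "m \<ge> 1" by (intro that[of "l - 1"]) linarith+
  note optimal_parameters_iff[OF assms(4), unfolded Let_def, THEN iffD1, OF l(2)[unfolded m(1)]]
  then have par: "r \<le> 3" "r * m < k" "k \<le> r * (m + 1)" "n + 1 = k + m * (\<delta> - 1) + 4"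
    and \<delta>: "\<delta> = 4 \<or> \<delta> = 3 \<and> k \<noteq> r * (m + 1)"
    by simp_all
  have "finite (UNIV :: 'q set)" using assms(1) by (intro card_ge_0_finite) simp
  then obtain e :: "nat \<Rightarrow> 'q" where "bij_betw e {0..<4} UNIV"
    using ex_bij_betw_nat_finite[of "UNIV :: 'q set"] unfolding assms(1) by blast
  then have e: "inj_on e {..<4}" by (simp add: bij_betw_def lessThan_atLeast0)
  \<comment> \<open>All three rows are block checks for \<open>\<delta> = 4\<close>; for
    \<open>\<delta> = 3\<close> the middle row is checked once on the whole word.\<close>
  define L :: "nat set" where "L = (if \<delta> = 4 then {0, 1, 2} else {0, 2})"
  have cL: "card L = \<delta> - 1" and L: "L = {0, 1, 2} \<or> L = {0, 2}" using \<delta> by (auto simp: L_def)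
  \<comment> \<open>Here \<open>n = k + m * card L + 3\<close>. For \<open>\<delta> = 3\<close> the
    summand 3 exceeds \<open>card L\<close> by one, which is made up for by
    \<open>k < r * (m + 1)\<close>.\<close>
  have short: "n \<le> (r + card L) * (m + 1)"
    using par(3,4) \<delta> unfolding cL by (elim disjE conjE) (simp_all add: algebra_simps)
  have "optimal_lrc n k 4 r (card L + 1) (block_code e (r + card L) n L)"
    by (rule block_code_optimal[OF assms(1) e L assms(4) par(1) m(2) par(2,3) _ short])
      (use par(4) cL in simp)
  then show ?lhs using cL assms(2) by auto
qed

end
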